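(* Let $m_T:=\max_{t\in[0,T]}|\zeta(\tfrac12+it)|$. For a function $k=k(T)$, say that the moment formula holds for $k$ if $$\frac{1}{T}\int_0^T |\zeta(\tfrac12+it)|^{2k}\,dt\ \sim\ \frac{G^2(k+1)}{G(2k+1)}\,a(k)\,(\log T)^{k^2}\qquad\text{with } k=k(T),\ \text{as } T\to\infty,$$ i.e. the ratio of the two sides tends to $1$ as $T\to\infty$. (1) If the moment formula holds for $k=(\log T)^\delta$ for some $\delta<\tfrac12$, then $$m_T\ll \exp\left((\log T)^{1-\delta}\right).$$ (2) If the moment formula holds for $k=\sqrt{2\log T/\log\log T}$, then $$m_T\ll\exp\left(\sqrt{\tfrac12\log T\log\log T}+O\left(\frac{\sqrt{\log T}\,\log\log\log T}{\sqrt{\log\log T}}\right)\right).$$ (3) If the moment formula holds for $k=\sqrt{8\log T/\log\log T}$, then $$m_T\gg\exp\left(\sqrt{\tfrac12\log T\log\log T}+O\left(\frac{\sqrt{\log T}\,\log\log\log T}{\sqrt{\log\log T}}\right)\right).$$ All estimates are for $T\to\infty$.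
   Context: Here $\zeta$ is the Riemann zeta-function, $G$ is the Barnes $G$-function, and $$a(k)=\prod_{p\ \mathrm{prime}}\left(1-\frac1p\right)^{k^2}\sum_{m=0}^\infty\left(\frac{\Gamma(m+k)}{m!\,\Gamma(k)}\right)^2p^{-m}.$$ $f\ll g$ means $|f|\le C|g|$ for some constant $C$ and all sufficiently large $T$; $f\gg g$ means $g\ll f$. *)

theory Defs
  imports
    "HOL-Complex_Analysis.Complex_Analysis"
    "HOL-Library.Landau_Symbols"
    "HOL-Real_Asymp.Real_Asymp"
    "HOL-Computational_Algebra.Primes"
begin

section \<open>The Riemann zeta-function\<close>

text \<open>
  The zeta-function is the analytic continuation of its Dirichlet series to the punctured plane.
  The value at the pole is unspecified.
\<close>

definition is_zeta_continuation :: "(complex \<Rightarrow> complex) \<Rightarrow> bool" where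
  "is_zeta_continuation f \<longleftrightarrow>
     f holomorphic_on (- {1}) \<and>
     (\<forall>s. Re s > 1 \<longrightarrow> (\<lambda>n. of_nat (Suc n) powr (- s)) sums f s)"

definition zeta :: "complex \<Rightarrow> complex" where
  "zeta = (SOME f. is_zeta_continuation f)"

text \<open>
  We now show that the continuation exists, so that the choice above is meaningful. With
  \<open>c j = ((1 - s) gchoose j) * (-1) ^ j\<close>, the series over \<open>n\<close> of
  \<open>n powr (1 - s) - (\<Sum>j\<le>N. c j * (n + 1) powr (1 - s - j))\<close> converges locally uniformly for
  \<open>Re s > 1 - N\<close>, and for \<open>Re s > 1\<close> it expresses \<open>(s - 1) * zeta s\<close> through
  \<open>zeta (s + 1)\<close>, \<dots>, \<open>zeta (s + N - 1)\<close>.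
\<close>

definition zeta_bterm :: "nat \<Rightarrow> nat \<Rightarrow> complex \<Rightarrow> complex" where
  "zeta_bterm j k s = ((1 - s) gchoose j) * (-1) ^ j * of_nat (k + 2) powr (1 - s - of_nat j)"

definition zeta_rem :: "nat \<Rightarrow> nat \<Rightarrow> complex \<Rightarrow> complex" where
  "zeta_rem N k s = of_nat (Suc k) powr (1 - s) - (\<Sum>j\<le>N. zeta_bterm j k s)"

lemma norm_of_nat_powr: "n > 0 \<Longrightarrow> norm (of_nat n powr s :: complex) = real n powr Re s"
  by (subst norm_powr_real_powr) (auto simp: powr_def)

lemma zeta_bterm_sums: "(\<lambda>j. zeta_bterm j k s) sums (of_nat (Suc k) powr (1 - s))"
proof -
  have "(\<lambda>n. ((1 - s) gchoose n) * of_real (real (k+2)) powr (1 - s - of_nat n) * of_real (-1) ^ n)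
          sums of_real (real (k + 2) + (-1)) powr (1 - s)"
    by (rule gen_binomial_complex'') simp
  then show ?thesis
    by (simp add: zeta_bterm_def mult_ac add_ac)
qed

lemma norm_gbinomial_le:
  fixes a :: complex
  assumes "norm a \<le> R"
  shows "norm (a gchoose j) \<le> pochhammer R j / fact j"
proof -
  have "norm (\<Prod>i = 0..<j. a - of_nat i) \<le> (\<Prod>i = 0..<j. R + of_nat i)"
    unfolding prod_norm [symmetric]
  proof (rule prod_mono, safe)
    fix i show "norm (a - of_nat i) \<le> R + of_nat i"
      using norm_triangle_ineq4[of a "of_nat i"] assms by simp
  qed auto
  then have "norm (\<Prod>i = 0..<j. a - of_nat i) / fact j \<le> (\<Prod>i = 0..<j. R + of_nat i) / fact j"
    by (intro divide_right_mono) auto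
  then show ?thesis
    by (simp add: gbinomial_prod_rev norm_divide pochhammer_prod)
qed

lemma summable_pochhammer_half: "summable (\<lambda>j. pochhammer (R::real) j / fact j * (1/2) ^ j)"
proof -
  have "(\<lambda>n. ((-R) gchoose n) * (-1/2) ^ n) sums (1 + (-1/2)) powr (-R)"
    by (rule gen_binomial_real) simp
  moreover have "((-R) gchoose n) * (-1/2) ^ n = pochhammer R n / fact n * (1/2) ^ n" for n
  proof -
    have "(-1/2 :: real) ^ n = (-1) ^ n * (1/2) ^ n"
      by (simp flip: power_mult_distrib)
    then show ?thesis
      by (simp add: gbinomial_pochhammer flip: power_mult_distrib)
  qed
  ultimately show ?thesis
    by (simp add: sums_iff)
qed

lemma zeta_rem_bound:
  assumes "norm (1 - s) \<le> R"
  shows "norm (zeta_rem N k s) \<le>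
           (\<Sum>j. pochhammer R (j + Suc N) / fact (j + Suc N) * (1/2) ^ j) *
             real (k + 2) powr (- Re s - real N)"
proof -
  define b where "b = (\<lambda>j. pochhammer R (j + Suc N) / fact (j + Suc N) * (1/2 :: real) ^ j)"
  define p where "p = real (k + 2) powr (- Re s - real N)"
  have sb: "summable b"
  proof -
    have "summable (\<lambda>j. pochhammer R (j + Suc N) / fact (j + Suc N) * (1/2) ^ (j + Suc N))"
      by (rule summable_ignore_initial_segment[OF summable_pochhammer_half])
    then have "summable (\<lambda>j. 2 ^ Suc N *
                 (pochhammer R (j + Suc N) / fact (j + Suc N) * (1/2) ^ (j + Suc N)))"
      by (rule summable_mult)
    moreover have "2 ^ Suc N * (pochhammer R (j + Suc N) / fact (j + Suc N) * (1/2) ^ (j + Suc N))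
        = b j" for j
    proof -
      have pw: "2 ^ Suc N * (1/2 :: real) ^ Suc N = 1"
        by (simp only: power_mult_distrib [symmetric]) simp
      have "2 ^ Suc N * (c * (1/2) ^ (j + Suc N)) = c * (1/2) ^ j * (2 ^ Suc N * (1/2) ^ Suc N)"
        for c :: real by (simp only: power_add mult_ac)
      then show ?thesis
        unfolding b_def pw by simp
    qed
    ultimately show ?thesis by simp
  qed
  have le: "norm (zeta_bterm (j + Suc N) k s) \<le> b j * p" for j
  proof -
    have pw: "real (k + 2) powr (1 - Re s - real (j + Suc N)) \<le> (1/2) ^ j * p"
    proof -
      have "real (k + 2) powr (1 - Re s - real (j + Suc N)) = real (k + 2) powr (- real j) * p"
        unfolding p_def powr_add [symmetric] by (rule arg_cong[where f = "(powr) (real (k + 2))"]) simp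
      moreover have "real (k + 2) powr (- real j) \<le> 2 powr (- real j)"
        by (rule powr_mono2') auto
      moreover have "2 powr (- real j) = (1/2) ^ j"
        by (simp add: powr_minus powr_realpow power_divide field_simps)
      moreover have "p \<ge> 0" by (simp add: p_def)
      ultimately show ?thesis by (simp add: mult_right_mono)
    qed
    have "norm (zeta_bterm (j + Suc N) k s) =
            norm ((1 - s) gchoose (j + Suc N)) * real (k + 2) powr (1 - Re s - real (j + Suc N))"
      unfolding zeta_bterm_def norm_mult norm_power
      by (simp add: norm_of_nat_powr del: of_nat_Suc of_nat_add)
    also have "\<dots> \<le> (pochhammer R (j + Suc N) / fact (j + Suc N)) * ((1/2) ^ j * p)"
      by (rule mult_mono[OF norm_gbinomial_le[OF assms] pw])
         (use order_trans[OF norm_ge_zero norm_gbinomial_le[OF assms, of "j + Suc N"]] in simp_all)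
    finally show ?thesis by (simp add: b_def mult_ac)
  qed
  have "(\<lambda>j. zeta_bterm (j + Suc N) k s) sums zeta_rem N k s"
    using sums_split_initial_segment[OF zeta_bterm_sums[of k s], of "Suc N"]
    by (simp add: zeta_rem_def lessThan_Suc_atMost del: of_nat_Suc)
  then have "zeta_rem N k s = (\<Sum>j. zeta_bterm (j + Suc N) k s)"
    by (simp add: sums_iff)
  also have "norm \<dots> \<le> (\<Sum>j. b j * p)"
    by (rule norm_suminf_le) (use le sb in \<open>auto intro: summable_mult2\<close>)
  also have "\<dots> = (\<Sum>j. b j) * p"
    by (rule suminf_mult2[OF sb, symmetric])
  finally show ?thesis by (simp add: b_def p_def)
qed

lemma zeta_rem_local:
  assumes s0: "Re s0 > 1 - real N"
  obtains d M where "d > 0" "cball s0 d \<subseteq> {s. Re s > 1 - real N}" "summable M"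
    "\<And>k s. s \<in> cball s0 d \<Longrightarrow> norm (zeta_rem N k s) \<le> M k"
proof -
  define d where "d = (Re s0 + real N - 1) / 2"
  have d: "d > 0" using s0 by (simp add: d_def)
  define R where "R = 1 + norm s0 + d"
  define C where "C = (\<Sum>j. pochhammer R (j + Suc N) / fact (j + Suc N) * (1/2) ^ j)"
  have ball: "Re s + real N \<ge> 1 + d \<and> norm (1 - s) \<le> R" if "s \<in> cball s0 d" for s
  proof -
    have n: "norm (s0 - s) \<le> d" using that by (simp add: dist_norm)
    then have "Re s0 - Re s \<le> d"
      using complex_Re_le_cmod[of "s0 - s"] by simp
    moreover have "norm (1 - s) \<le> R"
      using n norm_triangle_ineq4[of 1 s] norm_triangle_ineq3[of s s0]
      by (simp add: R_def norm_minus_commute)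
    ultimately show ?thesis unfolding d_def by (simp add: field_simps)
  qed
  have C0: "C \<ge> 0"
  proof -
    have "norm (zeta_rem N 0 s0) \<le> C * real (0 + 2) powr (- Re s0 - real N)"
      unfolding C_def by (rule zeta_rem_bound) (use ball[of s0] d in auto)
    from order_trans[OF norm_ge_zero this] show ?thesis
      by (simp add: zero_le_mult_iff)
  qed
  define M where "M = (\<lambda>k. C * real (k + 2) powr (- 1 - d))"
  show ?thesis
  proof (rule that[of d M])
    show "d > 0" by (rule d)
    show "cball s0 d \<subseteq> {s. Re s > 1 - real N}"
      using ball d by force
    have "summable (\<lambda>k. real k powr (- 1 - d))"
      using d by (simp add: summable_real_powr_iff)
    then show "summable M"
      unfolding M_def by (intro summable_mult summable_ignore_initial_segment)
    fix k s assume s: "s \<in> cball s0 d"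
    have "norm (zeta_rem N k s) \<le> C * real (k + 2) powr (- Re s - real N)"
      unfolding C_def by (rule zeta_rem_bound) (use ball[OF s] in auto)
    also have "\<dots> \<le> M k"
      unfolding M_def using ball[OF s] C0 by (intro mult_left_mono powr_mono) auto
    finally show "norm (zeta_rem N k s) \<le> M k" .
  qed
qed

lemma zeta_rem_summable:
  assumes "Re s > 1 - real N"
  shows "summable (\<lambda>k. zeta_rem N k s)"
proof -
  obtain d M where d: "d > 0" "summable M"
    "\<And>k s'. s' \<in> cball s d \<Longrightarrow> norm (zeta_rem N k s') \<le> M k"
    using zeta_rem_local[OF assms] by metis
  show ?thesis
    by (rule summable_comparison_test'[of M 0]) (use d in auto)
qed

lemma holomorphic_on_gchoose:
  assumes "f holomorphic_on A"
  shows "(\<lambda>s. (f s :: complex) gchoose j) holomorphic_on A"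
  unfolding gbinomial_prod_rev using assms by (auto intro!: holomorphic_intros)

lemma zeta_rem_suminf_holomorphic:
  "(\<lambda>s. \<Sum>k. zeta_rem N k s) holomorphic_on {s. Re s > 1 - real N}"
proof (rule holomorphic_uniform_sequence)
  show "open {s. Re s > 1 - real N}" by (rule open_halfspace_Re_gt)
  show "(\<lambda>s. \<Sum>k<n. zeta_rem N k s) holomorphic_on {s. Re s > 1 - real N}" for n
    unfolding zeta_rem_def zeta_bterm_def
    by (intro holomorphic_intros holomorphic_on_gchoose)
  fix s0 assume "s0 \<in> {s. Re s > 1 - real N}"
  then have "Re s0 > 1 - real N" by simp
  from zeta_rem_local[OF this] obtain d M where d: "d > 0" "cball s0 d \<subseteq> {s. Re s > 1 - real N}" "summable M"
    "\<And>k s. s \<in> cball s0 d \<Longrightarrow> norm (zeta_rem N k s) \<le> M k"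
    by metis
  have "uniform_limit (cball s0 d) (\<lambda>n s. \<Sum>k<n. zeta_rem N k s) (\<lambda>s. \<Sum>k. zeta_rem N k s) sequentially"
    by (rule Weierstrass_m_test[OF d(4) d(3)])
  with d show "\<exists>d>0. cball s0 d \<subseteq> {s. Re s > 1 - real N} \<and>
      uniform_limit (cball s0 d) (\<lambda>n s. \<Sum>k<n. zeta_rem N k s) (\<lambda>s. \<Sum>k. zeta_rem N k s) sequentially"
    by blast
qed

definition dirichlet_zeta :: "complex \<Rightarrow> complex" where
  "dirichlet_zeta s = (\<Sum>n. of_nat (Suc n) powr (- s))"

lemma dirichlet_zeta_sums:
  assumes "Re s > 1"
  shows "(\<lambda>n. of_nat (Suc n) powr (- s)) sums dirichlet_zeta s"
proof -
  have "summable (\<lambda>n. real n powr (- Re s))"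
    using assms by (simp add: summable_real_powr_iff)
  then have "summable (\<lambda>n. real (n + 1) powr (- Re s))"
    by (rule summable_ignore_initial_segment)
  then have "summable (\<lambda>n. of_nat (Suc n) powr (- s) :: complex)"
    by (rule summable_comparison_test'[where N = 0])
       (simp add: norm_of_nat_powr del: of_nat_Suc)
  then show ?thesis by (simp add: dirichlet_zeta_def sums_iff)
qed

lemma dirichlet_zeta_sums':
  assumes "Re s > 1"
  shows "(\<lambda>k. of_nat (k + 2) powr (- s)) sums (dirichlet_zeta s - 1)"
  using sums_split_initial_segment[OF dirichlet_zeta_sums[OF assms], of 1] by simp

lemma zeta_rem_suminf:
  assumes s: "Re s > 1"
  shows "(\<Sum>k. zeta_rem (Suc M) k s) = 1 -
           (\<Sum>j=1..Suc M. ((1 - s) gchoose j) * (-1) ^ j * (dirichlet_zeta (s + of_nat j - 1) - 1))"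
proof -
  have tel: "(\<lambda>k. of_nat (Suc k) powr (1 - s) - of_nat (Suc (Suc k)) powr (1 - s)) sums
               (of_nat (Suc 0) powr (1 - s) - 0)"
  proof (rule telescope_sums')
    have "(\<lambda>k. real (Suc k) powr (1 - Re s)) \<longlonglongrightarrow> 0"
      using s by real_asymp
    then show "(\<lambda>k. of_nat (Suc k) powr (1 - s) :: complex) \<longlonglongrightarrow> 0"
      by (rule Lim_null_comparison[rotated])
         (simp add: norm_of_nat_powr del: of_nat_Suc)
  qed
  have bt: "(\<lambda>k. zeta_bterm j k s) sums
      (((1 - s) gchoose j) * (-1) ^ j * (dirichlet_zeta (s + of_nat j - 1) - 1))" if "j \<in> {1..Suc M}" for j
  proof -
    have "Re (s + of_nat j - 1) > 1" using that s by simp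
    from sums_mult[OF dirichlet_zeta_sums'[OF this], of "((1 - s) gchoose j) * (-1) ^ j"]
    show ?thesis by (simp add: zeta_bterm_def algebra_simps)
  qed
  have eq: "zeta_rem (Suc M) k s = of_nat (Suc k) powr (1 - s) - of_nat (Suc (Suc k)) powr (1 - s)
               - (\<Sum>j=1..Suc M. zeta_bterm j k s)" for k
  proof -
    have "(\<Sum>j\<le>Suc M. zeta_bterm j k s) = zeta_bterm 0 k s + (\<Sum>j=1..Suc M. zeta_bterm j k s)"
      by (simp only: atMost_atLeast0 sum.atLeast_Suc_atMost[OF le0]) simp
    then show ?thesis by (simp add: zeta_rem_def zeta_bterm_def)
  qed
  have "(\<lambda>k. zeta_rem (Suc M) k s) sums (of_nat (Suc 0) powr (1 - s) - 0 -
           (\<Sum>j=1..Suc M. ((1 - s) gchoose j) * (-1) ^ j * (dirichlet_zeta (s + of_nat j - 1) - 1)))"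
    unfolding eq by (intro sums_diff[OF tel] sums_sum bt)
  then show ?thesis by (simp add: sums_iff)
qed

lemma gchoose_absorb_pole:
  "((1 - s) gchoose Suc i) * (-1) ^ Suc i =
     (-1) ^ i * ((1 - s) gchoose i) / of_nat (Suc i) * (s + of_nat (Suc i) - 2)" for s :: complex
proof -
  define q where "q = 1 - s - of_nat i"
  have "of_nat (Suc i) * ((1 - s) gchoose Suc i) = q * ((1 - s) gchoose i)"
    unfolding q_def using gbinomial_mult_1[of "1 - s" i]
    by (simp only: left_diff_distrib) (simp add: algebra_simps)
  then have "((1 - s) gchoose Suc i) = q * ((1 - s) gchoose i) / of_nat (Suc i)"
    by (simp add: field_simps del: of_nat_Suc)
  moreover have "s + of_nat (Suc i) - 2 = - q"
    by (simp add: q_def)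
  ultimately show ?thesis
    by (simp only: power_Suc) (simp add: mult_ac del: of_nat_Suc)
qed

lemma zeta_continuation_step:
  assumes h: "M > 0 \<Longrightarrow> h holomorphic_on {s. Re s > 1 - real M}"
    and h_eq: "\<And>s. M > 0 \<Longrightarrow> Re s > 1 \<Longrightarrow> h s = (s - 1) * dirichlet_zeta s"
  obtains H where "H holomorphic_on {s. Re s > 1 - real (Suc M)}"
    "\<And>s. Re s > 1 \<Longrightarrow> H s = (s - 1) * dirichlet_zeta s"
proof -
  define H where "H = (\<lambda>s. s - (\<Sum>k. zeta_rem (Suc M) k s) -
     (\<Sum>i=1..M. (-1) ^ i * ((1 - s) gchoose i) / of_nat (Suc i) * h (s + of_nat i)
               - ((1 - s) gchoose Suc i) * (-1) ^ Suc i))"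
  show ?thesis
  proof (rule that[of H])
    have hi: "(\<lambda>s. h (s + of_nat i)) holomorphic_on {s. Re s > 1 - real (Suc M)}" if "i \<in> {1..M}" for i
    proof -
      have "h holomorphic_on (\<lambda>s. s + of_nat i) ` {s. Re s > 1 - real (Suc M)}"
        by (rule holomorphic_on_subset[OF h]) (use that in auto)
      then have "(h \<circ> (\<lambda>s. s + of_nat i)) holomorphic_on {s. Re s > 1 - real (Suc M)}"
        by (intro holomorphic_on_compose holomorphic_intros)
      then show ?thesis by (simp add: o_def)
    qed
    show "H holomorphic_on {s. Re s > 1 - real (Suc M)}"
      unfolding H_def
      by (intro holomorphic_intros zeta_rem_suminf_holomorphic hi holomorphic_on_gchoose)
         (auto simp del: of_nat_Suc)
    fix s :: complex assume s: "Re s > 1"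
    have "(\<Sum>k. zeta_rem (Suc M) k s) = 1 - (s - 1) * (dirichlet_zeta s - 1) -
           (\<Sum>i=1..M. ((1 - s) gchoose Suc i) * (-1) ^ Suc i * (dirichlet_zeta (s + of_nat i) - 1))"
    proof -
      have "(\<Sum>j=1..Suc M. ((1 - s) gchoose j) * (-1) ^ j * (dirichlet_zeta (s + of_nat j - 1) - 1)) =
            ((1 - s) gchoose 1) * (-1) ^ 1 * (dirichlet_zeta (s + of_nat 1 - 1) - 1) +
            (\<Sum>j=Suc 1..Suc M. ((1 - s) gchoose j) * (-1) ^ j * (dirichlet_zeta (s + of_nat j - 1) - 1))"
        by (rule sum.atLeast_Suc_atMost) simp
      also have "(\<Sum>j=Suc 1..Suc M. ((1 - s) gchoose j) * (-1) ^ j * (dirichlet_zeta (s + of_nat j - 1) - 1))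
        = (\<Sum>i=1..M. ((1 - s) gchoose Suc i) * (-1) ^ Suc i * (dirichlet_zeta (s + of_nat i) - 1))"
        by (subst sum.shift_bounds_cl_Suc_ivl) (simp add: algebra_simps)
      finally show ?thesis
        unfolding zeta_rem_suminf[OF s] by (simp add: algebra_simps)
    qed
    moreover have term_eq: "(-1) ^ i * ((1 - s) gchoose i) / of_nat (Suc i) * h (s + of_nat i) =
        ((1 - s) gchoose Suc i) * (-1) ^ Suc i * dirichlet_zeta (s + of_nat i)" if "i \<in> {1..M}" for i
    proof -
      have "h (s + of_nat i) = (s + of_nat i - 1) * dirichlet_zeta (s + of_nat i)"
        using that s by (intro h_eq) auto
      then show ?thesis
        unfolding gchoose_absorb_pole by (simp del: of_nat_Suc) simp
    qed
    moreover have "(\<Sum>i=1..M. (-1) ^ i * ((1 - s) gchoose i) / of_nat (Suc i) * h (s + of_nat i)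
               - ((1 - s) gchoose Suc i) * (-1) ^ Suc i) =
        (\<Sum>i=1..M. ((1 - s) gchoose Suc i) * (-1) ^ Suc i * (dirichlet_zeta (s + of_nat i) - 1))"
      by (rule sum.cong) (simp_all only: term_eq right_diff_distrib mult_1_right)
    ultimately show "H s = (s - 1) * dirichlet_zeta s"
      unfolding H_def by (simp only:) (simp add: algebra_simps)
  qed
qed

lemma zeta_continuation_halfplane:
  "\<exists>h. h holomorphic_on {s. Re s > 1 - real (Suc M)} \<and>
       (\<forall>s. Re s > 1 \<longrightarrow> h s = (s - 1) * dirichlet_zeta s)"
proof (induction M)
  case 0
  obtain H where "H holomorphic_on {s. Re s > 1 - real (Suc 0)}"
    "\<And>s. Re s > 1 \<Longrightarrow> H s = (s - 1) * dirichlet_zeta s"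
    by (rule zeta_continuation_step[of 0]) auto
  then show ?case by blast
next
  case (Suc M)
  then obtain h where h: "h holomorphic_on {s. Re s > 1 - real (Suc M)}"
    "\<And>s. Re s > 1 \<Longrightarrow> h s = (s - 1) * dirichlet_zeta s"
    by blast
  obtain H where "H holomorphic_on {s. Re s > 1 - real (Suc (Suc M))}"
    "\<And>s. Re s > 1 \<Longrightarrow> H s = (s - 1) * dirichlet_zeta s"
    using h by (rule zeta_continuation_step[of "Suc M"]) auto
  then show ?case by blast
qed

lemma zeta_continuation_exists: "\<exists>f. is_zeta_continuation f"
proof -
  define D where "D = (\<lambda>M. {s. Re s > 1 - real (Suc M)})"
  obtain h where h: "\<And>M. h M holomorphic_on D M"
    and h_eq: "\<And>M s. Re s > 1 \<Longrightarrow> h M s = (s - 1) * dirichlet_zeta s"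
    using zeta_continuation_halfplane unfolding D_def by metis
  have unique: "h M s = h N s" if "M \<le> N" "s \<in> D M" for M N s
  proof -
    have sub: "D M \<subseteq> D N" using that by (auto simp: D_def)
    have "h M s - h N s = 0"
    proof (rule analytic_continuation[of "\<lambda>s. h M s - h N s" "D M" "{s. Re s > 1}" 2])
      show "(\<lambda>s. h M s - h N s) holomorphic_on D M"
        by (intro holomorphic_intros h holomorphic_on_subset[OF h sub])
      show "open (D M)" unfolding D_def by (rule open_halfspace_Re_gt)
      show "connected (D M)" unfolding D_def by (intro convex_connected convex_halfspace_Re_gt)
      show "{s. Re s > 1} \<subseteq> D M" "(2::complex) \<in> D M" by (auto simp: D_def)
      show "(2::complex) islimpt {s. Re s > 1}"
        by (rule interior_limit_point) (simp add: interior_open open_halfspace_Re_gt)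
      show "h M z - h N z = 0" if "z \<in> {s. Re s > 1}" for z
        using that by (simp add: h_eq)
    qed (rule that)
    then show ?thesis by simp
  qed
  define m where "m = (\<lambda>s. nat \<lceil>1 - Re s\<rceil>)"
  have m: "s \<in> D (m s)" for s unfolding D_def m_def by (simp add: of_nat_nat) linarith
  define f where "f = (\<lambda>s. h (m s) s / (s - 1))"
  have f_eq: "f s = h M s / (s - 1)" if "s \<in> D M" for s M
    using unique[of M "m s" s] unique[of "m s" M s] that m[of s] unfolding f_def by (metis nle_le)
  have "\<exists>f'. (f has_field_derivative f') (at s)" if s: "s \<noteq> 1" for s
  proof -
    define U where "U = D (m s) - {1}"
    have op: "open U" unfolding U_def D_def by (intro open_Diff open_halfspace_Re_gt) auto
    have "(\<lambda>z. h (m s) z / (z - 1)) holomorphic_on U"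
      unfolding U_def by (intro holomorphic_intros holomorphic_on_subset[OF h]) auto
    then have "f holomorphic_on U"
      by (rule holomorphic_transform) (auto simp: U_def f_eq)
    moreover have "s \<in> U" using s m by (simp add: U_def)
    ultimately show ?thesis
      using holomorphic_on_open[OF op] by blast
  qed
  then have "f holomorphic_on - {1}"
    by (subst holomorphic_on_open) auto
  moreover have "(\<lambda>n. of_nat (Suc n) powr (- s)) sums f s" if "Re s > 1" for s
  proof -
    have "s \<noteq> 1" using that by auto
    then have "f s = dirichlet_zeta s" using that by (simp add: f_def h_eq)
    then show ?thesis using dirichlet_zeta_sums[OF that] by simp
  qed
  ultimately show ?thesis unfolding is_zeta_continuation_def by blast
qed

lemma zeta_holomorphic: "zeta holomorphic_on - {1}"
  and zeta_sums: "Re s > 1 \<Longrightarrow> (\<lambda>n. of_nat (Suc n) powr (- s)) sums zeta s"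
proof -
  have "is_zeta_continuation zeta"
    unfolding zeta_def by (rule someI_ex[OF zeta_continuation_exists])
  then show "zeta holomorphic_on - {1}"
    and "Re s > 1 \<Longrightarrow> (\<lambda>n. of_nat (Suc n) powr (- s)) sums zeta s"
    unfolding is_zeta_continuation_def by blast+
qed

text \<open>
  For \<open>T \<ge> 0\<close> the supremum is attained (lemma \<open>zeta_max_attained\<close>), so it is a maximum.
\<close>

definition zeta_max :: "real \<Rightarrow> real" where
  "zeta_max T = (SUP t\<in>{0..T}. norm (zeta (Complex (1/2) t)))"

lemma zeta_critical_line_continuous: "continuous_on A (\<lambda>t. zeta (Complex (1/2) t))"
proof (rule continuous_on_compose2[OF holomorphic_on_imp_continuous_on[OF zeta_holomorphic]])
  show "continuous_on A (\<lambda>t. Complex (1/2) t)"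
    by (intro continuous_intros)
qed (auto simp: complex_eq_iff)

lemma zeta_max_attained:
  assumes "T \<ge> 0"
  shows "\<exists>t\<in>{0..T}. zeta_max T = norm (zeta (Complex (1/2) t)) \<and>
           (\<forall>u\<in>{0..T}. norm (zeta (Complex (1/2) u)) \<le> norm (zeta (Complex (1/2) t)))"
proof -
  have "continuous_on {0..T} (\<lambda>t. norm (zeta (Complex (1/2) t)))"
    by (intro continuous_intros zeta_critical_line_continuous)
  then obtain t where t: "t \<in> {0..T}"
    "\<forall>u\<in>{0..T}. norm (zeta (Complex (1/2) u)) \<le> norm (zeta (Complex (1/2) t))"
    using continuous_attains_sup[of "{0..T}"] assms by (metis atLeastAtMost_iff compact_Icc empty_iff order_refl)
  then have "zeta_max T = norm (zeta (Complex (1/2) t))"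
    unfolding zeta_max_def by (intro cSup_eq_maximum) auto
  with t show ?thesis by blast
qed

section \<open>The conjectural asymptotics for the moments\<close>

text \<open>
  The Weierstrass product of the Barnes \<open>G\<close>-function at \<open>z = w + 1\<close>.
\<close>

definition Barnes_G :: "'a :: {banach, real_normed_field} \<Rightarrow> 'a" where
  "Barnes_G z = (let w = z - 1 in
     exp (w / 2 * of_real (ln (2 * pi)) - (w + w\<^sup>2 * (1 + euler_mascheroni)) / 2) *
     (\<Prod>n. (1 + w / of_nat (Suc n)) ^ Suc n * exp (w\<^sup>2 / (2 * of_nat (Suc n)) - w)))"

definition arith_factor :: "real \<Rightarrow> real" where
  "arith_factor k = (\<Prod>p. if prime p
     then (1 - 1 / real p) powr k\<^sup>2 *
            (\<Sum>m. (Gamma (real m + k) / (fact m * Gamma k))\<^sup>2 / real p ^ m)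
     else 1)"

definition moment_formula :: "(real \<Rightarrow> real) \<Rightarrow> bool" where
  "moment_formula k \<longleftrightarrow>
     (\<lambda>T. 1 / T * integral {0..T} (\<lambda>t. norm (zeta (Complex (1/2) t)) powr (2 * k T)))
     \<sim>[at_top]
     (\<lambda>T. (Barnes_G (k T + 1))\<^sup>2 / Barnes_G (2 * k T + 1) * arith_factor (k T) * ln T powr (k T)\<^sup>2)"

end

theory Submission
  imports Defs
begin

text \<open>
  Put \<open>L = ln T\<close>. The constant \<open>G(k+1)\<^sup>2 / G(2k+1) * a(k)\<close> is
  \<open>exp (- k\<^sup>2 ln k + O (k\<^sup>2 ln ln k))\<close> as \<open>k \<rightarrow> \<infinity>\<close>, so the moment formula says
  that the logarithm of the \<open>2k\<close>-th moment is \<open>k\<^sup>2 (ln L - ln k) + O (k\<^sup>2 ln ln k)\<close>.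
  Since the moment is at most \<open>m\<^sub>T\<close> to the power \<open>2k\<close>, this bounds \<open>m\<^sub>T\<close> from below.
  Conversely, if \<open>D\<close> bounds the derivative on the critical line, then \<open>\<bar>\<zeta>\<bar> \<ge> m\<^sub>T / 2\<close>
  on an interval of length \<open>1 / (2D)\<close>, whence
  \<open>2k ln (m\<^sub>T / 2) \<le> L + ln (2D) + ln (moment)\<close>. The trivial \<open>D = O (T)\<close> costs a constant
  factor in the exponent but already gives \<open>ln m\<^sub>T = O (L / k)\<close>. Interpolating this
  bound on the critical line with the trivial one off the line improves the derivative bound to
  \<open>D = O (L m\<^sub>2\<^sub>T)\<close>, and the second application of the same inequality is sharp.
\<close>

section \<open>Growth of zeta near the critical line\<close>

text \<open>The constants 2 and 8 come from one computation. Put \<open>x = ln T\<close> and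
  \<open>k^2 = c * x / ln x\<close>. Then \<open>ln k\<close> is \<open>ln x / 2\<close> up to a
  term of size \<open>ln (ln x)\<close>, so the logarithm of the moment divided by
  \<open>2 * k\<close> is about \<open>k * ln x / 4\<close>, that is
  \<open>sqrt c / 4 * sqrt (x * ln x)\<close>. The lower bound reaches
  \<open>sqrt (x * ln x / 2)\<close> at \<open>c = 8\<close>. The upper bound has the additional
  term \<open>x / (2 * k)\<close>, which is \<open>1 / (2 * sqrt c) * sqrt (x * ln x)\<close>; the
  sum of the two is smallest at \<open>c = 2\<close>, where it has the same value. The obstacle is
  the derivative. A bound \<open>D\<close> of size \<open>T\<close> would double the term
  \<open>x / (2 * k)\<close>. This spoils the balance at \<open>c = 2\<close>, and for
  \<open>k = x powr d\<close> it yields \<open>x powr (1 - d)\<close> plus an unbounded excess. What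
  can be afforded is \<open>ln D = o(x)\<close>, and \<open>ln D = O(x / k)\<close> is far below the
  permitted error. That error, of size \<open>k * ln (ln x)\<close>, has two sources: the term
  \<open>ln (ln x)\<close> in \<open>ln k\<close>, and the primes below about \<open>k^2\<close> in
  \<open>a(k)\<close>.\<close>

lemma convex_of_real_atLeast: "convex (complex_of_real ` {a..})"
  by (intro convex_linear_image convex_real_interval bounded_linear.linear bounded_linear_of_real)

lemma norm_powr_minus_diff_le:
  assumes a: "a > 0" and s: "Re s > 0" and x: "x \<ge> a"
  shows "norm (of_real x powr (- s) - of_real a powr (- s) :: complex) \<le>
           norm s * a powr (- Re s - 1) * (x - a)"
proof -
  let ?S = "complex_of_real ` {a..}"
  have "norm ((of_real x :: complex) powr (- s) - of_real a powr (- s)) \<le>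
          norm s * a powr (- Re s - 1) * norm (complex_of_real x - of_real a)"
  proof (rule field_differentiable_bound[OF convex_of_real_atLeast[of a],
        where f' = "\<lambda>z. - s * z powr (- s - 1)"])
    fix z assume "z \<in> ?S"
    then obtain y where y: "z = of_real y" "y \<ge> a" by auto
    show "((\<lambda>z. z powr - s) has_field_derivative - s * z powr (- s - 1)) (at z within ?S)"
      using y a by (auto intro!: derivative_eq_intros simp: complex_nonpos_Reals_iff)
    have "norm (- s * z powr (- s - 1)) = norm s * y powr (- Re s - 1)"
      using y a by (simp add: norm_mult norm_powr_real_powr)
    also have "\<dots> \<le> norm s * a powr (- Re s - 1)"
      using y a s by (intro mult_left_mono powr_mono2') auto
    finally show "norm (- s * z powr (- s - 1)) \<le> norm s * a powr (- Re s - 1)" .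
  qed (use x in auto)
  moreover have "norm (complex_of_real x - of_real a) = x - a"
    using x by (simp flip: of_real_diff)
  ultimately show ?thesis by simp
qed

text \<open>The \<open>n\<close>-th term minus the integral of \<open>x powr (- s)\<close> over the next unit interval.\<close>

definition zeta_em_term :: "nat \<Rightarrow> complex \<Rightarrow> complex" where
  "zeta_em_term n s = of_nat (Suc n) powr (- s)
     - (of_nat (Suc (Suc n)) powr (1 - s) - of_nat (Suc n) powr (1 - s)) / (1 - s)"

text \<open>With \<open>a = n + 1\<close>, the term is the increment over [a, a + 1] of
  \<open>?F\<close>, a primitive of \<open>a powr (- s) - z powr (- s)\<close>. The mean value
  inequality thus replaces an estimate of the integral.\<close>

lemma norm_zeta_em_term_le:
  assumes s: "Re s > 0" "s \<noteq> 1"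
  shows "norm (zeta_em_term n s) \<le> norm s * real (Suc n) powr (- Re s - 1)"
proof -
  define a where "a = real (Suc n)"
  have a: "a > 0" by (simp add: a_def)
  \<comment> \<open>The disc cuts the ray down to the segment from \<open>a\<close> to
    \<open>a + 1\<close>, where the derivative of \<open>?F\<close> is bounded; both sets are
    convex.\<close>
  let ?S = "complex_of_real ` {a..} \<inter> cball (of_real a) 1"
  let ?F = "\<lambda>z. z * of_real a powr (- s) - z powr (1 - s) / (1 - s)"
  have conv: "convex ?S" by (intro convex_Int convex_of_real_atLeast convex_cball)
  have "norm (?F (of_real (a + 1)) - ?F (of_real a)) \<le>
          norm s * a powr (- Re s - 1) * norm (complex_of_real (a + 1) - of_real a)"
  proof (rule field_differentiable_bound[OF conv,
        where f' = "\<lambda>z. of_real a powr (- s) - z powr (- s)"])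
    fix z assume "z \<in> ?S"
    then obtain y where y: "z = of_real y" "y \<ge> a" "dist (complex_of_real a) (of_real y) \<le> 1" by auto
    then have y1: "y - a \<le> 1" by (simp add: dist_norm flip: of_real_diff)
    have "((\<lambda>z. z powr (1 - s)) has_field_derivative (1 - s) * z powr ((1 - s) - 1)) (at z within ?S)"
      using y a by (auto intro!: derivative_eq_intros simp: complex_nonpos_Reals_iff)
    then have "((\<lambda>z. z powr (1 - s) / (1 - s)) has_field_derivative
          z powr (- s)) (at z within ?S)"
      using DERIV_cdivide[of _ _ z ?S "1 - s"] s by fastforce
    moreover have "((\<lambda>z. z * of_real a powr (- s)) has_field_derivative of_real a powr (- s)) (at z within ?S)"
      by (auto intro!: derivative_eq_intros)
    ultimately show "(?F has_field_derivative of_real a powr (- s) - z powr (- s)) (at z within ?S)"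
      by (rule DERIV_diff[rotated])
    have "norm (of_real a powr (- s) - z powr (- s)) \<le> norm s * a powr (- Re s - 1) * (y - a)"
      using norm_powr_minus_diff_le[OF a s(1) y(2)] y(1) by (simp add: norm_minus_commute)
    also have "\<dots> \<le> norm s * a powr (- Re s - 1) * 1"
      using y1 by (intro mult_left_mono) auto
    finally show "norm (of_real a powr (- s) - z powr (- s)) \<le> norm s * a powr (- Re s - 1)" by simp
  next
    show "complex_of_real (a + 1) \<in> ?S"
      by (rule IntI, rule imageI) (auto simp: dist_norm)
  qed auto
  moreover have "?F (of_real (a + 1)) - ?F (of_real a) = zeta_em_term n s"
    by (simp add: a_def zeta_em_term_def diff_divide_distrib algebra_simps)
  ultimately show ?thesis by (simp add: a_def)
qed

lemma summable_Suc_powr: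
  assumes "c > 0"
  shows "summable (\<lambda>n. real (Suc n) powr (- c - 1))"
  using assms by (subst summable_Suc_iff) (simp add: summable_real_powr_iff)

lemma zeta_em_suminf_holomorphic:
  "(\<lambda>s. \<Sum>n. zeta_em_term n s) holomorphic_on {s. Re s > 0} - {1}"
proof (rule holomorphic_uniform_sequence)
  let ?U = "{s. Re s > 0} - {1}"
  show op: "open ?U" by (intro open_Diff open_halfspace_Re_gt) auto
  show "(\<lambda>s. \<Sum>n<N. zeta_em_term n s) holomorphic_on ?U" for N
    unfolding zeta_em_term_def by (intro holomorphic_intros) (auto simp: of_nat_Suc simp del: of_nat_Suc)
  fix s0 :: complex assume "s0 \<in> ?U"
  then obtain d0 where d0: "d0 > 0" "cball s0 d0 \<subseteq> ?U"
    using op open_contains_cball by blast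
  \<comment> \<open>The cap \<open>Re s0 / 2\<close> keeps \<open>Re s\<close> away from 0 on the
    disc, so that a single summable majorant serves all its points.\<close>
  define d where "d = min d0 (Re s0 / 2)"
  have d: "d > 0" "cball s0 d \<subseteq> ?U" using d0 \<open>s0 \<in> ?U\<close> by (auto simp: d_def subset_iff)
  have re: "Re s \<ge> Re s0 / 2 \<and> norm s \<le> norm s0 + d" if "s \<in> cball s0 d" for s
  proof -
    have n: "norm (s0 - s) \<le> d" using that by (simp add: dist_norm)
    then have "Re s0 - Re s \<le> Re s0 / 2"
      using complex_Re_le_cmod[of "s0 - s"] by (simp add: d_def)
    then show ?thesis using n norm_triangle_ineq3[of s s0] by (simp add: norm_minus_commute)
  qed
  have "uniform_limit (cball s0 d) (\<lambda>N s. \<Sum>n<N. zeta_em_term n s) (\<lambda>s. \<Sum>n. zeta_em_term n s) sequentially"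
  proof (rule Weierstrass_m_test)
    fix n s assume s: "s \<in> cball s0 d"
    then have "s \<in> ?U" using d by blast
    then have "norm (zeta_em_term n s) \<le> norm s * real (Suc n) powr (- Re s - 1)"
      by (intro norm_zeta_em_term_le) auto
    also have "\<dots> \<le> (norm s0 + d) * real (Suc n) powr (- (Re s0 / 2) - 1)"
      using re[OF s] d by (intro mult_mono powr_mono) auto
    finally show "norm (zeta_em_term n s) \<le> (norm s0 + d) * real (Suc n) powr (- (Re s0 / 2) - 1)" .
  next
    show "summable (\<lambda>n. (norm s0 + d) * real (Suc n) powr (- (Re s0 / 2) - 1))"
      using \<open>s0 \<in> ?U\<close> by (intro summable_mult summable_Suc_powr) auto
  qed
  with d show "\<exists>d>0. cball s0 d \<subseteq> ?U \<and>
     uniform_limit (cball s0 d) (\<lambda>N s. \<Sum>n<N. zeta_em_term n s) (\<lambda>s. \<Sum>n. zeta_em_term n s) sequentially"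
    by blast
qed

text \<open>For \<open>Re s > 1\<close> the subtracted integrals telescope to
  \<open>1 / (s - 1)\<close>, and the identity theorem does the rest. Unlike the series behind the
  existence proof, this one gives an explicit bound that is linear in \<open>norm s\<close>.\<close>

lemma zeta_eq_em_series:
  assumes "Re s > 0" "s \<noteq> 1"
  shows "zeta s = 1 / (s - 1) + (\<Sum>n. zeta_em_term n s)"
proof -
  let ?U = "{s. Re s > 0} - {1 :: complex}"
  have op: "open ?U" by (intro open_Diff open_halfspace_Re_gt) auto
  have "zeta s - 1 / (s - 1) - (\<Sum>n. zeta_em_term n s) = 0"
  proof (rule analytic_continuation[of "\<lambda>s. zeta s - 1 / (s - 1) - (\<Sum>n. zeta_em_term n s)" ?U
          "{s. Re s > 1}" 2])
    show "(\<lambda>s. zeta s - 1 / (s - 1) - (\<Sum>n. zeta_em_term n s)) holomorphic_on ?U"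
      by (intro holomorphic_intros zeta_em_suminf_holomorphic holomorphic_on_subset[OF zeta_holomorphic]) auto
    show "open ?U" by (rule op)
    show "connected ?U"
      by (intro connected_open_delete open_halfspace_Re_gt convex_connected convex_halfspace_Re_gt) simp
    show "{s. Re s > 1} \<subseteq> ?U" "(2::complex) \<in> ?U" by auto
    show "(2::complex) islimpt {s. Re s > 1}"
      by (rule interior_limit_point) (simp add: interior_open open_halfspace_Re_gt)
    show "s \<in> ?U" using assms by auto
    fix z :: complex assume "z \<in> {s. Re s > 1}"
    then have z: "Re z > 1" "z \<noteq> 1" by auto
    have "(\<lambda>k. of_nat (Suc (Suc k)) powr (1 - z) - of_nat (Suc k) powr (1 - z)) sums
               (0 - of_nat (Suc 0) powr (1 - z))"
    proof (rule telescope_sums)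
      have "(\<lambda>k. real (Suc k) powr (1 - Re z)) \<longlonglongrightarrow> 0"
        using z by real_asymp
      then show "(\<lambda>k. of_nat (Suc k) powr (1 - z) :: complex) \<longlonglongrightarrow> 0"
        by (rule Lim_null_comparison[rotated])
           (simp add: norm_of_nat_powr del: of_nat_Suc)
    qed
    from sums_diff[OF zeta_sums[OF z(1)] sums_divide[OF this, of "1 - z"]]
    have "(\<lambda>n. zeta_em_term n z) sums (zeta z - (0 - of_nat (Suc 0) powr (1 - z)) / (1 - z))"
      by (simp only: zeta_em_term_def)
    then have "(\<lambda>n. zeta_em_term n z) sums (zeta z + 1 / (1 - z))"
      by simp
    moreover have "1 / (1 - z) = - (1 / (z - 1))"
      using z(2) by (simp add: divide_simps)
    ultimately show "zeta z - 1 / (z - 1) - (\<Sum>n. zeta_em_term n z) = 0"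
      by (simp add: sums_iff)
  qed
  then show ?thesis by (simp add: algebra_simps)
qed

text \<open>The bound has to extend to the left of the critical line, since Cauchy's inequality for
  the derivative uses whole discs; radii up to 1/4 are enough.\<close>

lemma norm_zeta_le:
  obtains C where "C > 0" "\<And>s. Re s \<ge> 1/4 \<Longrightarrow> s \<noteq> 1 \<Longrightarrow> norm (zeta s) \<le> 1 / norm (s - 1) + C * norm s"
proof -
  define C where "C = 1 + (\<Sum>n. real (Suc n) powr (- (1/4) - 1))"
  have sm: "summable (\<lambda>n. real (Suc n) powr (- (1/4) - 1))"
    by (rule summable_Suc_powr) auto
  have C: "C > 0" unfolding C_def by (intro add_pos_nonneg suminf_nonneg sm) auto
  show ?thesis
  proof (rule that[OF C])
    fix s :: complex assume s: "Re s \<ge> 1/4" "s \<noteq> 1"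
    have le: "norm (zeta_em_term n s) \<le> norm s * real (Suc n) powr (- (1/4) - 1)" for n
    proof -
      have "norm (zeta_em_term n s) \<le> norm s * real (Suc n) powr (- Re s - 1)"
        by (intro norm_zeta_em_term_le) (use s in auto)
      also have "\<dots> \<le> norm s * real (Suc n) powr (- (1/4) - 1)"
        using s by (intro mult_left_mono powr_mono) auto
      finally show ?thesis .
    qed
    have "norm (zeta s) = norm (1 / (s - 1) + (\<Sum>n. zeta_em_term n s))"
      using s by (subst zeta_eq_em_series) auto
    also have "\<dots> \<le> norm (1 / (s - 1)) + norm (\<Sum>n. zeta_em_term n s)"
      by (rule norm_triangle_ineq)
    also have "norm (\<Sum>n. zeta_em_term n s) \<le> (\<Sum>n. norm s * real (Suc n) powr (- (1/4) - 1))"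
      by (intro norm_suminf_le le summable_mult sm)
    also have "\<dots> = norm s * (C - 1)"
      by (subst suminf_mult[OF sm]) (simp add: C_def)
    also have "\<dots> \<le> C * norm s" by (simp add: algebra_simps)
    finally show "norm (zeta s) \<le> 1 / norm (s - 1) + C * norm s"
      by (simp add: norm_divide)
  qed
qed

section \<open>Interpolation near the critical line and bounds for the derivative\<close>

text \<open>A quantitative maximum principle of three-lines type. The crude bound exceeds a constant
  by \<open>exp L\<close> at distance 1/4 from the edge, so interpolation at distance
  \<open>1 / L\<close> loses only a factor \<open>exp (O(1))\<close>.\<close>

lemma rectangle_edge_bound:
  assumes L: "L \<ge> 1" and M: "M \<ge> 0" and C: "C \<ge> 0"
  assumes hol: "g holomorphic_on cbox (Complex 0 (-L)) (Complex (1/4) L)"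
  assumes edge: "\<And>z. Re z = 0 \<Longrightarrow> \<bar>Im z\<bar> \<le> L \<Longrightarrow> norm (g z) \<le> M"
  assumes crude: "\<And>z. 0 \<le> Re z \<Longrightarrow> Re z \<le> 1/4 \<Longrightarrow> \<bar>Im z\<bar> \<le> L \<Longrightarrow> norm (g z) \<le> C * exp L"
  assumes z: "0 \<le> Re z" "Re z \<le> 1/4" "Re z \<le> 1 / L" "\<bar>Im z\<bar> \<le> 1"
  shows "norm (g z) \<le> exp 6 * (M + C)"
proof -
  define Q where "Q = cbox (Complex 0 (-L)) (Complex (1/4) L)"
  have Q: "w \<in> Q \<longleftrightarrow> 0 \<le> Re w \<and> Re w \<le> 1/4 \<and> \<bar>Im w\<bar> \<le> L" for w
    by (auto simp: Q_def in_cbox_complex_iff)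
  \<comment> \<open>The Gaussian disposes of the horizontal sides. The linear factor cancels \<open>exp L\<close> on the far
    side and changes the size of \<open>g\<close> only by a bounded factor at distance \<open>1 / L\<close>.\<close>
  define F where "F = (\<lambda>w. g w * exp (w\<^sup>2 - 4 * of_real L * w))"
  have norm_exp: "norm (exp (w\<^sup>2 - 4 * complex_of_real L * w)) = exp ((Re w)\<^sup>2 - (Im w)\<^sup>2 - 4 * L * Re w)" for w
    by (simp add: Re_power2)
  have holF: "F holomorphic_on Q"
    unfolding F_def Q_def by (intro holomorphic_intros hol)
  have "norm (F z) \<le> exp 1 * (M + C)"
  proof (rule maximum_modulus_frontier[of F Q])
    show "F holomorphic_on interior Q" "continuous_on (closure Q) F" "bounded Q"
      using holF holomorphic_on_subset[OF holF interior_subset] holomorphic_on_imp_continuous_on[OF holF]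
      by (auto simp: Q_def)
    show "z \<in> Q" using z L by (auto simp: Q)
    fix w assume "w \<in> frontier Q"
    then have wQ: "w \<in> Q" and bd: "Re w = 0 \<or> Re w = 1/4 \<or> \<bar>Im w\<bar> = L"
      by (auto simp: Q_def frontier_cbox in_cbox_complex_iff in_box_complex_iff)
    have sq: "(Re w)\<^sup>2 \<le> 1"
      using wQ by (subst abs_square_le_1) (auto simp: Q)
    have LL: "L \<le> L\<^sup>2" using L by (simp add: power2_eq_square)
    show "norm (F w) \<le> exp 1 * (M + C)"
    proof (cases "Re w = 0")
      case True
      have "norm (F w) \<le> M * exp 1"
        unfolding F_def norm_mult norm_exp
        by (intro mult_mono edge) (use True wQ M in \<open>auto simp: Q intro: order_trans[of _ 0]\<close>)
      then show ?thesis using C by (simp add: algebra_simps add_increasing add_increasing2)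
    next
      case False
      have "(Re w)\<^sup>2 - (Im w)\<^sup>2 - 4 * L * Re w \<le> 1 - L"
      proof (cases "Re w = 1/4")
        case True
        then have "4 * L * Re w = L" by simp
        then show ?thesis using sq zero_le_power2[of "Im w"] by linarith
      next
        case False
        with bd \<open>Re w \<noteq> 0\<close> have "\<bar>Im w\<bar> = L" by auto
        then have "(Im w)\<^sup>2 = L\<^sup>2" by (metis power2_abs)
        moreover have "4 * L * Re w \<ge> 0" using L wQ by (simp add: Q)
        ultimately show ?thesis using sq LL by linarith
      qed
      then have "norm (F w) \<le> (C * exp L) * exp (1 - L)"
        unfolding F_def norm_mult norm_exp
        by (intro mult_mono crude) (use wQ C in \<open>auto simp: Q\<close>)
      also have "\<dots> = C * exp 1" by (simp flip: exp_add)
      finally show ?thesis using M by (simp add: algebra_simps add_increasing add_increasing2)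
    qed
  qed
  moreover have "norm (g z) = norm (F z) * exp (4 * L * Re z + (Im z)\<^sup>2 - (Re z)\<^sup>2)"
    unfolding F_def norm_mult norm_exp by (simp flip: exp_add)
  \<comment> \<open>Undoing the auxiliary factor at \<open>z\<close> costs 4 for the linear part,
    because \<open>Re z \<le> 1 / L\<close>, and 1 for the Gaussian, because
    \<open>\<bar>Im z\<bar> \<le> 1\<close>. Together with the 1 from the frontier this is the 6 in
    the claim.\<close>
  moreover have "4 * L * Re z + (Im z)\<^sup>2 - (Re z)\<^sup>2 \<le> 5"
  proof -
    have "4 * (L * Re z) \<le> 4" using z L by (simp add: field_simps)
    moreover have "(Im z)\<^sup>2 \<le> 1" using z by (subst abs_square_le_1) auto
    moreover have "(Re z)\<^sup>2 \<ge> 0" by simp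
    ultimately show ?thesis by linarith
  qed
  ultimately have "norm (g z) \<le> (exp 1 * (M + C)) * exp 5"
    using M C by (auto intro!: mult_mono)
  also have "\<dots> = exp 6 * (M + C)" by (simp add: mult_ac flip: exp_add)
  finally show ?thesis .
qed

lemma norm_zeta_le_zeta_max:
  assumes "0 \<le> t" "t \<le> T"
  shows "norm (zeta (Complex (1/2) t)) \<le> zeta_max T"
  using zeta_max_attained[of T] assms by force

lemma zeta_max_nonneg: "T \<ge> 0 \<Longrightarrow> zeta_max T \<ge> 0"
  using norm_zeta_le_zeta_max[of 0 T] norm_ge_zero order_trans by blast

text \<open>Two ways to stay clear of the pole: at height at least 1 its distance is at least 1, and
  on the critical line, at any height, at least 1/2.\<close>

lemma zeta_strip_bound:
  obtains C where "C \<ge> 1"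
    "\<And>s T. T \<ge> 1 \<Longrightarrow> Re s \<in> {1/4..3/4} \<Longrightarrow> 1 \<le> Im s \<Longrightarrow> Im s \<le> 2 * T \<Longrightarrow> norm (zeta s) \<le> C * T"
    "\<And>t T. T \<ge> 1 \<Longrightarrow> t \<in> {0..T} \<Longrightarrow> norm (zeta (Complex (1/2) t)) \<le> C * T"
proof -
  obtain C where C: "C > 0" "\<And>s. Re s \<ge> 1/4 \<Longrightarrow> s \<noteq> 1 \<Longrightarrow> norm (zeta s) \<le> 1 / norm (s - 1) + C * norm s"
    using norm_zeta_le by blast
  show ?thesis
  proof (rule that[of "2 + 3 * C"])
    show "2 + 3 * C \<ge> 1" using C by simp
    fix s T assume *: "(T::real) \<ge> 1" "Re s \<in> {1/4..3/4}" "1 \<le> Im s" "Im s \<le> 2 * T"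
    have "norm (s - 1) \<ge> 1"
      using abs_Im_le_cmod[of "s - 1"] * by simp
    then have 1: "1 / norm (s - 1) \<le> 1" by (auto simp: divide_simps)
    have "norm s \<le> 3 * T"
      using cmod_le[of s] * by simp
    then have 2: "C * norm s \<le> C * (3 * T)" using C by simp
    have "s \<noteq> 1" using * by auto
    then have "norm (zeta s) \<le> 1 / norm (s - 1) + C * norm s"
      using C(2)[of s] * by auto
    with 1 2 have "norm (zeta s) \<le> 1 + C * (3 * T)"
      by linarith
    also have "\<dots> \<le> (2 + 3 * C) * T" using * by (simp add: algebra_simps)
    finally show "norm (zeta s) \<le> (2 + 3 * C) * T" .
  next
    fix t T assume *: "(T::real) \<ge> 1" "t \<in> {0..T}"
    define s where "s = Complex (1/2) t"
    have "norm (s - 1) \<ge> 1/2"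
      using abs_Re_le_cmod[of "s - 1"] by (simp add: s_def)
    then have "1 / norm (s - 1) \<le> 2" by (auto simp: divide_simps split: if_splits)
    moreover have "norm s \<le> 3 * T"
      using cmod_le[of s] * by (simp add: s_def)
    then have "C * norm s \<le> C * (3 * T)" using C by simp
    moreover have "s \<noteq> 1" by (auto simp: s_def complex_eq_iff)
    ultimately have "norm (zeta s) \<le> 2 + C * (3 * T)"
      using C(2)[of s] by (auto simp: s_def)
    also have "\<dots> \<le> (2 + 3 * C) * T" using * by (simp add: algebra_simps)
    finally show "norm (zeta (Complex (1/2) t)) \<le> (2 + 3 * C) * T" by (simp add: s_def)
  qed
qed

lemma norm_deriv_zeta_le:
  assumes "t \<ge> 2" "0 < r" "r \<le> 1/4"
    and "\<And>s. norm (s - Complex (1/2) t) = r \<Longrightarrow> norm (zeta s) \<le> B"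
  shows "norm (deriv zeta (Complex (1/2) t)) \<le> B / r"
proof -
  have "(1 :: complex) \<notin> cball (Complex (1/2) t) r"
    using abs_Im_le_cmod[of "Complex (1/2) t - 1"] assms by (auto simp: dist_norm)
  then have hol: "zeta holomorphic_on cball (Complex (1/2) t) r"
    by (intro holomorphic_on_subset[OF zeta_holomorphic]) auto
  have "norm ((deriv ^^ 1) zeta (Complex (1/2) t)) \<le> fact 1 * B / r ^ 1"
    using assms hol
    by (intro Cauchy_inequality holomorphic_on_imp_continuous_on holomorphic_on_subset[OF hol])
       (auto simp: norm_minus_commute)
  then show ?thesis by simp
qed

lemma deriv_zeta_crude:
  obtains C where "C \<ge> 1"
    "\<And>t T. 2 \<le> t \<Longrightarrow> t \<le> T \<Longrightarrow> norm (deriv zeta (Complex (1/2) t)) \<le> C * T"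
proof -
  obtain C where C: "C \<ge> 1"
    "\<And>s T. T \<ge> 1 \<Longrightarrow> Re s \<in> {1/4..3/4} \<Longrightarrow> 1 \<le> Im s \<Longrightarrow> Im s \<le> 2 * T \<Longrightarrow> norm (zeta s) \<le> C * T"
    by (rule zeta_strip_bound) blast
  show ?thesis
  proof (rule that[of "4 * C"])
    fix t T :: real assume t: "2 \<le> t" "t \<le> T"
    have "norm (deriv zeta (Complex (1/2) t)) \<le> (C * T) / (1/4)"
    proof (rule norm_deriv_zeta_le)
      fix s assume s: "norm (s - Complex (1/2) t) = 1/4"
      then have "\<bar>Re s - 1/2\<bar> \<le> 1/4" "\<bar>Im s - t\<bar> \<le> 1/4"
        using abs_Re_le_cmod[of "s - Complex (1/2) t"] abs_Im_le_cmod[of "s - Complex (1/2) t"] by auto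
      then have "Re s \<in> {1/4..3/4}" "1 \<le> Im s" "Im s \<le> 2 * T"
        using t unfolding atLeastAtMost_iff by linarith+
      then show "norm (zeta s) \<le> C * T" using t by (intro C) auto
    qed (use t in auto)
    then show "norm (deriv zeta (Complex (1/2) t)) \<le> (4 * C) * T" by simp
  qed (use C in auto)
qed

text \<open>Taking \<open>L = ln T\<close> turns the crude bound \<open>C * T\<close> into
  \<open>C * exp L\<close>, as the rectangle argument wants, and Cauchy's inequality is applied on a
  circle of radius \<open>1 / L\<close>. The rectangle has half-height \<open>L\<close>: hence
  \<open>2 * ln T \<le> t\<close> at the bottom, and \<open>2 * T\<close> in \<open>zeta_max\<close>
  at the top.\<close>

lemma deriv_zeta_refined:
  obtains C where "C \<ge> 1"
    "\<And>t T. T \<ge> exp 4 \<Longrightarrow> 2 * ln T \<le> t \<Longrightarrow> t \<le> T \<Longrightarrow>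
       norm (deriv zeta (Complex (1/2) t)) \<le> C * ln T * (zeta_max (2 * T) + 1)"
proof -
  obtain C where C: "C \<ge> 1"
    "\<And>s T. T \<ge> 1 \<Longrightarrow> Re s \<in> {1/4..3/4} \<Longrightarrow> 1 \<le> Im s \<Longrightarrow> Im s \<le> 2 * T \<Longrightarrow> norm (zeta s) \<le> C * T"
    by (rule zeta_strip_bound) blast
  show ?thesis
  proof (rule that[of "exp 6 * C"])
    show "exp 6 * C \<ge> 1" using C mult_mono[of 1 "exp 6" 1 C] by simp
    fix t T :: real assume T: "T \<ge> exp 4" and t: "2 * ln T \<le> t" "t \<le> T"
    define L where "L = ln T"
    define M where "M = zeta_max (2 * T)"
    have T0: "T > 0" using T exp_gt_zero[of 4] by linarith
    have L: "L \<ge> 4" unfolding L_def using T T0 by (simp add: ln_ge_iff)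
    have expL: "exp L = T" using T0 by (simp add: L_def)
    have T1: "T \<ge> 1" using expL L one_le_exp_iff[of L] by linarith
    have LT: "L \<le> T" unfolding L_def using ln_le_minus_one[OF T0] by linarith
    have M: "M \<ge> 0" unfolding M_def using T1 by (intro zeta_max_nonneg) auto
    define s0 where "s0 = Complex (1/2) t"
    \<comment> \<open>The sign \<open>e\<close> places the rectangle to the right or to the left of
      the critical line, so that both halves of the circle are covered.\<close>
    have one_side: "norm (zeta (s0 + of_real e * z)) \<le> exp 6 * (M + C)"
      if e: "e = 1 \<or> e = -1" and z: "0 \<le> Re z" "Re z \<le> 1/4" "Re z \<le> 1 / L" "\<bar>Im z\<bar> \<le> 1" for e z
    proof (rule rectangle_edge_bound[where g = "\<lambda>z. zeta (s0 + of_real e * z)" and L = L and z = z])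
      have im: "Im (s0 + of_real e * w) \<in> {L..t + L}" if "\<bar>Im w\<bar> \<le> L" for w
        using that e t by (auto simp: s0_def L_def)
      show "(\<lambda>z. zeta (s0 + of_real e * z)) holomorphic_on cbox (Complex 0 (- L)) (Complex (1 / 4) L)"
      proof (rule holomorphic_on_compose_gen[of _ _ zeta "- {1}", unfolded o_def])
        show "(\<lambda>z. s0 + of_real e * z) ` cbox (Complex 0 (- L)) (Complex (1 / 4) L) \<subseteq> - {1}"
          using im L by (fastforce simp: in_cbox_complex_iff abs_le_iff)
      qed (auto intro!: holomorphic_intros zeta_holomorphic)
      fix w :: complex
      show "norm (zeta (s0 + of_real e * w)) \<le> M" if "Re w = 0" "\<bar>Im w\<bar> \<le> L"
      proof -
        have "s0 + of_real e * w = Complex (1/2) (Im (s0 + of_real e * w))"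
          using that by (simp add: complex_eq_iff s0_def)
        moreover have "norm (zeta (Complex (1/2) (Im (s0 + of_real e * w)))) \<le> M"
          unfolding M_def using im[OF that(2)] t L LT by (intro norm_zeta_le_zeta_max) auto
        ultimately show ?thesis by metis
      qed
      show "norm (zeta (s0 + of_real e * w)) \<le> C * exp L" if "0 \<le> Re w" "Re w \<le> 1/4" "\<bar>Im w\<bar> \<le> L"
        unfolding expL using im[OF that(3)] that e t L LT T1
        by (intro C) (auto simp: s0_def)
    qed (use z L C M in auto)
    have "norm (deriv zeta (Complex (1/2) t)) \<le> (exp 6 * (M + C)) / (1 / L)"
    proof (rule norm_deriv_zeta_le)
      show "t \<ge> 2" "0 < 1 / L" "1 / L \<le> 1/4" using t L by (auto simp: L_def divide_simps)
      fix s assume s: "norm (s - Complex (1/2) t) = 1 / L"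
      then have d: "\<bar>Re s - 1/2\<bar> \<le> 1 / L" "\<bar>Im s - t\<bar> \<le> 1 / L" "1 / L \<le> 1/4"
        using abs_Re_le_cmod[of "s - Complex (1/2) t"] abs_Im_le_cmod[of "s - Complex (1/2) t"] L
        by (simp_all add: s)
      define e :: real where "e = (if Re s \<ge> 1/2 then 1 else -1)"
      have "norm (zeta (s0 + of_real e * (of_real e * (s - s0)))) \<le> exp 6 * (M + C)"
        using d by (intro one_side) (auto simp: e_def s0_def abs_le_iff)
      then show "norm (zeta s) \<le> exp 6 * (M + C)" by (auto simp: e_def split: if_splits)
    qed
    also have "\<dots> = exp 6 * L * (M + C)" by simp
    also have "\<dots> \<le> exp 6 * L * (C * (M + 1))"
      using L C M mult_right_mono[of 1 C M] by (intro mult_left_mono) (auto simp: algebra_simps)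
    finally show "norm (deriv zeta (Complex (1/2) t)) \<le> exp 6 * C * ln T * (zeta_max (2 * T) + 1)"
      by (simp add: L_def M_def mult_ac)
  qed
qed

section \<open>The Barnes $G$-function on the real axis\<close>

definition Barnes_log_term :: "real \<Rightarrow> nat \<Rightarrow> real" where
  "Barnes_log_term w n = real (Suc n) * ln (1 + w / real (Suc n)) + w\<^sup>2 / (2 * real (Suc n)) - w"

lemma ln_one_plus_bounds:
  fixes x :: real
  assumes "x \<ge> 0"
  shows "ln (1 + x) \<ge> x - x\<^sup>2 / 2" "ln (1 + x) \<le> x - x\<^sup>2 / 2 + x ^ 3 / 3"
proof -
  define f where "f = (\<lambda>y::real. ln (1 + y) - (y - y\<^sup>2 / 2))"
  define g where "g = (\<lambda>y::real. y - y\<^sup>2 / 2 + y ^ 3 / 3 - ln (1 + y))"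
  have "f 0 \<le> f x"
  proof (rule DERIV_nonneg_imp_nondecreasing[OF assms])
    fix y :: real assume y: "0 \<le> y"
    have "(f has_real_derivative 1 / (1 + y) - (1 - y)) (at y)"
      unfolding f_def using y by (auto intro!: derivative_eq_intros)
    moreover have "1 / (1 + y) - (1 - y) = y\<^sup>2 / (1 + y)"
      using y by (simp add: field_simps power2_eq_square)
    moreover have "y\<^sup>2 / (1 + y) \<ge> 0" using y by simp
    ultimately show "\<exists>D. (f has_real_derivative D) (at y) \<and> 0 \<le> D"
      by auto
  qed
  then show "ln (1 + x) \<ge> x - x\<^sup>2 / 2" by (simp add: f_def)
  have "g 0 \<le> g x"
  proof (rule DERIV_nonneg_imp_nondecreasing[OF assms])
    fix y :: real assume y: "0 \<le> y"
    have "(g has_real_derivative (1 - y + y\<^sup>2) - 1 / (1 + y)) (at y)"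
      unfolding g_def using y by (auto intro!: derivative_eq_intros)
    moreover have "(1 - y + y\<^sup>2) - 1 / (1 + y) = y ^ 3 / (1 + y)"
      using y by (simp add: field_simps power2_eq_square power3_eq_cube)
    moreover have "y ^ 3 / (1 + y) \<ge> 0" using y by simp
    ultimately show "\<exists>D. (g has_real_derivative D) (at y) \<and> 0 \<le> D"
      by auto
  qed
  then show "ln (1 + x) \<le> x - x\<^sup>2 / 2 + x ^ 3 / 3" by (simp add: g_def)
qed

text \<open>The convergence factor cancels the Taylor polynomial of degree two of the logarithm,
  which leaves a nonnegative cubic remainder.\<close>

lemma Barnes_log_term_bounds:
  assumes "w \<ge> 0"
  shows "Barnes_log_term w n \<ge> 0" "Barnes_log_term w n \<le> w ^ 3 / 3 / (real (Suc n))\<^sup>2"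
proof -
  define N where "N = real (Suc n)"
  have N: "N > 0" by (simp add: N_def)
  have x: "w / N \<ge> 0" using assms N by simp
  have "N * (w / N - (w / N)\<^sup>2 / 2) \<le> N * ln (1 + w / N)"
    using N by (intro mult_left_mono ln_one_plus_bounds(1)[OF x]) auto
  moreover have "N * (w / N - (w / N)\<^sup>2 / 2) = w - w\<^sup>2 / (2 * N)"
    using N by (simp add: field_simps power2_eq_square)
  ultimately show "Barnes_log_term w n \<ge> 0"
    unfolding Barnes_log_term_def N_def[symmetric] by linarith
  have "N * ln (1 + w / N) \<le> N * (w / N - (w / N)\<^sup>2 / 2 + (w / N) ^ 3 / 3)"
    using N by (intro mult_left_mono ln_one_plus_bounds(2)[OF x]) auto
  moreover have "N * (w / N - (w / N)\<^sup>2 / 2 + (w / N) ^ 3 / 3) = w - w\<^sup>2 / (2 * N) + w ^ 3 / 3 / N\<^sup>2"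
    using N by (simp add: field_simps power2_eq_square power3_eq_cube)
  ultimately show "Barnes_log_term w n \<le> w ^ 3 / 3 / (real (Suc n))\<^sup>2"
    unfolding Barnes_log_term_def N_def[symmetric] by linarith
qed

lemma inverse_square_tail:
  assumes "N > 0"
  shows "summable (\<lambda>n. 1 / (real (Suc (n + N)))\<^sup>2)" "(\<Sum>n. 1 / (real (Suc (n + N)))\<^sup>2) \<le> 1 / real N"
proof -
  have "(\<lambda>n. 1 / real (n + N) - 1 / real (Suc n + N)) sums (1 / real (0 + N) - 0)"
    by (rule telescope_sums') real_asymp
  then have s: "(\<lambda>n. 1 / real (n + N) - 1 / real (Suc n + N)) sums (1 / real N)" by simp
  have le: "1 / (real (Suc (n + N)))\<^sup>2 \<le> 1 / real (n + N) - 1 / real (Suc n + N)" for n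
  proof -
    have "1 / (real (Suc (n + N)))\<^sup>2 \<le> 1 / (real (n + N) * real (Suc n + N))"
      using assms by (intro divide_left_mono) (auto simp: power2_eq_square intro!: mult_right_mono)
    also have "\<dots> = 1 / real (n + N) - 1 / real (Suc n + N)"
      using assms by (simp add: field_simps)
    finally show ?thesis .
  qed
  show sm: "summable (\<lambda>n. 1 / (real (Suc (n + N)))\<^sup>2)"
    by (rule summable_comparison_test'[OF sums_summable[OF s], of 0]) (use le in auto)
  show "(\<Sum>n. 1 / (real (Suc (n + N)))\<^sup>2) \<le> 1 / real N"
    using suminf_le[OF le sm sums_summable[OF s]] s by (simp add: sums_iff)
qed

lemma Barnes_log_term_summable:
  assumes "w \<ge> 0"
  shows "summable (Barnes_log_term w)"
proof -
  have "summable (\<lambda>n. 1 / (real (Suc n))\<^sup>2)"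
    using inverse_square_tail(1)[of 1] summable_iff_shift[of "\<lambda>n. 1 / (real (Suc n))\<^sup>2" 1] by simp
  then have "summable (\<lambda>n. w ^ 3 / 3 * (1 / (real (Suc n))\<^sup>2))"
    by (rule summable_mult)
  then show ?thesis
    by (rule summable_comparison_test'[of _ 0]) (use Barnes_log_term_bounds[OF assms] in auto)
qed

lemma Barnes_G_eq_exp:
  assumes "w \<ge> (0::real)"
  shows "Barnes_G (w + 1) = exp (w / 2 * ln (2 * pi) - (w + w\<^sup>2 * (1 + euler_mascheroni)) / 2 +
           (\<Sum>n. Barnes_log_term w n))"
proof -
  have "(1 + w / real (Suc n)) ^ Suc n * exp (w\<^sup>2 / (2 * real (Suc n)) - w) = exp (Barnes_log_term w n)" for n
  proof -
    have "1 + w / real (Suc n) > 0" using assms by (intro add_pos_nonneg) auto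
    then have "(1 + w / real (Suc n)) ^ Suc n = exp (real (Suc n) * ln (1 + w / real (Suc n)))"
      by (simp only: exp_of_nat_mult exp_ln)
    then show ?thesis by (simp only: Barnes_log_term_def add_diff_eq [symmetric] exp_add)
  qed
  then have "(\<Prod>n. (1 + w / real (Suc n)) ^ Suc n * exp (w\<^sup>2 / (2 * real (Suc n)) - w)) =
      exp (\<Sum>n. Barnes_log_term w n)"
    by (simp only: prodinf_exp[OF Barnes_log_term_summable[OF assms]])
  then show ?thesis
    by (simp only: Barnes_G_def Let_def add_diff_cancel_right' exp_add of_real_eq_id id_apply)
qed

lemma Barnes_G_pos: "w \<ge> (0::real) \<Longrightarrow> Barnes_G (w + 1) > 0"
  by (simp add: Barnes_G_eq_exp)

lemma harm_bounds:
  assumes "N > 0"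
  shows "harm N \<ge> ln (real N)" "harm N \<le> 1 + ln (real N)"
proof -
  have "ln (real N) \<le> ln (real N + 1)" using assms by simp
  then show "harm N \<ge> ln (real N)" using harm_ge_ln[of N] by linarith
  show "harm N \<le> 1 + ln (real N)"
    using assms euler_mascheroni_sequence_decreasing[of 1 N] by (simp add: harm_expand)
qed

text \<open>The sum is cut at \<open>N\<close> of size \<open>w\<close>. Beyond the cut the cubic
  remainders add up to \<open>O(w^3 / N)\<close>. Below it the logarithms and the terms
  \<open>- w\<close> contribute \<open>O(N * w)\<close>, and the main term is \<open>w^2 / 2\<close>
  times a harmonic number.\<close>

lemma Barnes_log_sum_bound:
  assumes "w \<ge> 1"
  shows "\<bar>(\<Sum>n. Barnes_log_term w n) - w\<^sup>2 / 2 * ln w\<bar> \<le> 5 * w\<^sup>2"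
proof -
  define N where "N = nat \<lceil>w\<rceil>"
  have N: "N > 0" "real N \<ge> w" "real N \<le> 2 * w"
    using assms unfolding N_def by linarith+
  have split: "(\<Sum>n. Barnes_log_term w n) = (\<Sum>n. Barnes_log_term w (n + N)) + (\<Sum>n<N. Barnes_log_term w n)"
    using assms by (intro suminf_split_initial_segment Barnes_log_term_summable) auto
  have sm: "summable (\<lambda>n. Barnes_log_term w (n + N))"
    using assms by (intro summable_ignore_initial_segment Barnes_log_term_summable) auto
  have tail: "0 \<le> (\<Sum>n. Barnes_log_term w (n + N))" "(\<Sum>n. Barnes_log_term w (n + N)) \<le> w\<^sup>2"
  proof -
    show "0 \<le> (\<Sum>n. Barnes_log_term w (n + N))"
      using assms by (intro suminf_nonneg sm Barnes_log_term_bounds) auto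
    have "(\<Sum>n. Barnes_log_term w (n + N)) \<le> (\<Sum>n. w ^ 3 / 3 * (1 / (real (Suc (n + N)))\<^sup>2))"
      using assms Barnes_log_term_bounds(2)[of w "_ + N"]
      by (intro suminf_le sm summable_mult inverse_square_tail N) (simp only: mult_1_right times_divide_eq_right)
    also have "\<dots> = w ^ 3 / 3 * (\<Sum>n. 1 / (real (Suc (n + N)))\<^sup>2)"
      by (intro suminf_mult inverse_square_tail N)
    also have "\<dots> \<le> w ^ 3 / 3 * (1 / real N)"
      using assms by (intro mult_left_mono inverse_square_tail N) auto
    also have "\<dots> \<le> w ^ 3 / 3 * (1 / w)"
      using assms N by (intro mult_left_mono) (auto simp: divide_simps)
    also have "\<dots> \<le> w\<^sup>2"
      using assms by (simp add: power2_eq_square power3_eq_cube)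
    finally show "(\<Sum>n. Barnes_log_term w (n + N)) \<le> w\<^sup>2" .
  qed
  have head: "(\<Sum>n<N. Barnes_log_term w n) =
       (\<Sum>n<N. real (Suc n) * ln (1 + w / real (Suc n))) + w\<^sup>2 / 2 * harm N - real N * w"
  proof -
    have "(\<Sum>n<N. w\<^sup>2 / (2 * real (Suc n))) = w\<^sup>2 / 2 * harm N"
      unfolding harm_altdef sum_distrib_left by (intro sum.cong refl) (simp add: field_simps del: of_nat_Suc)
    then show ?thesis
      by (simp only: Barnes_log_term_def sum_subtractf sum.distrib sum_constant card_lessThan)
  qed
  have lnsum: "0 \<le> (\<Sum>n<N. real (Suc n) * ln (1 + w / real (Suc n)))"
    "(\<Sum>n<N. real (Suc n) * ln (1 + w / real (Suc n))) \<le> real N * w"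
  proof -
    show "0 \<le> (\<Sum>n<N. real (Suc n) * ln (1 + w / real (Suc n)))"
      using assms by (intro sum_nonneg mult_nonneg_nonneg) auto
    have "real (Suc n) * ln (1 + w / real (Suc n)) \<le> w" for n
    proof -
      have "real (Suc n) * ln (1 + w / real (Suc n)) \<le> real (Suc n) * (w / real (Suc n))"
        using assms by (intro mult_left_mono ln_add_one_self_le_self) auto
      then show ?thesis by simp
    qed
    then have "(\<Sum>n<N. real (Suc n) * ln (1 + w / real (Suc n))) \<le> (\<Sum>n<N. w)"
      by (intro sum_mono)
    then show "(\<Sum>n<N. real (Suc n) * ln (1 + w / real (Suc n))) \<le> real N * w" by simp
  qed
  have "ln w \<le> ln (real N)" using N assms by (subst ln_le_cancel_iff) auto
  moreover have "ln (real N) \<le> ln (2 * w)" using N assms by (subst ln_le_cancel_iff) auto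
  moreover have "ln (2 * w) = ln 2 + ln w" using assms by (simp add: ln_mult)
  moreover have "ln 2 \<le> (1::real)" using ln_2_less_1 by linarith
  ultimately have h: "ln w \<le> harm N" "harm N \<le> 2 + ln w"
    using harm_bounds[OF N(1)] by linarith+
  have h': "w\<^sup>2 / 2 * ln w \<le> w\<^sup>2 / 2 * harm N" "w\<^sup>2 / 2 * harm N \<le> w\<^sup>2 / 2 * (2 + ln w)"
    by (intro mult_left_mono h; simp)+
  have Nw: "real N * w \<le> 2 * w\<^sup>2"
    using mult_right_mono[OF N(3), of w] assms by (simp add: power2_eq_square)
  have "w\<^sup>2 / 2 * (2 + ln w) = w\<^sup>2 + w\<^sup>2 / 2 * ln w" by (simp add: algebra_simps)
  then show ?thesis
    unfolding split head using tail lnsum h' Nw zero_le_power2[of w] unfolding abs_le_iff by (intro conjI) linarith+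
qed

lemma Barnes_G_asymp:
  obtains C :: real where "C \<ge> 0" "\<And>w. w \<ge> 1 \<Longrightarrow> \<bar>ln (Barnes_G (w + 1)) - w\<^sup>2 / 2 * ln w\<bar> \<le> C * w\<^sup>2"
proof -
  define A where "A = ln (2 * pi) + euler_mascheroni + 1"
  have A: "ln (2 * pi) \<ge> 0" using pi_gt3 by (intro ln_ge_zero) auto
  have g: "euler_mascheroni > (0::real)" by (rule euler_mascheroni_pos)
  show ?thesis
  proof (rule that[of "A + 5"])
    show "A + 5 \<ge> 0" using A g by (simp add: A_def)
    fix w :: real assume w: "w \<ge> 1"
    define P where "P = w / 2 * ln (2 * pi) - (w + w\<^sup>2 * (1 + euler_mascheroni)) / 2"
    have ww: "w \<le> w\<^sup>2" using w by (simp add: power2_eq_square)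
    have *: "w * ln (2 * pi) \<le> w\<^sup>2 * ln (2 * pi)" "w * ln (2 * pi) \<ge> 0" "w\<^sup>2 * euler_mascheroni \<ge> 0"
      using ww A w g by (auto intro!: mult_right_mono)
    have "\<bar>P\<bar> \<le> A * w\<^sup>2"
    proof -
      have "P = w * ln (2 * pi) / 2 - (w + w\<^sup>2 + w\<^sup>2 * euler_mascheroni) / 2"
        "A * w\<^sup>2 = w\<^sup>2 * ln (2 * pi) + w\<^sup>2 * euler_mascheroni + w\<^sup>2"
        by (simp_all add: P_def A_def algebra_simps)
      moreover have "\<bar>a / 2 - (w + w\<^sup>2 + g) / 2\<bar> \<le> b + g + w\<^sup>2" if "a \<le> b" "0 \<le> a" "0 \<le> g" for a b g :: real
        using that ww w unfolding abs_le_iff by (intro conjI) (simp_all add: field_simps)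
      ultimately show ?thesis using * by simp
    qed
    moreover have "ln (Barnes_G (w + 1)) = P + (\<Sum>n. Barnes_log_term w n)"
      using w by (subst Barnes_G_eq_exp) (auto simp: P_def)
    ultimately show "\<bar>ln (Barnes_G (w + 1)) - w\<^sup>2 / 2 * ln w\<bar> \<le> (A + 5) * w\<^sup>2"
      using Barnes_log_sum_bound[OF w] by (simp add: distrib_right)
  qed
qed

section \<open>The arithmetic factor\<close>

lemma prod_primes_dvd:
  fixes m :: nat
  assumes "finite A" "\<And>p. p \<in> A \<Longrightarrow> prime p" "\<And>p. p \<in> A \<Longrightarrow> p dvd m"
  shows "\<Prod>A dvd m"
  using assms
proof (induction A rule: finite_induct)
  case (insert p A)
  have "coprime p (\<Prod>A)"
    using insert by (intro prod_coprime_right primes_coprime) auto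
  then have "p * \<Prod>A dvd m"
    using insert by (intro divides_mult) auto
  then show ?case using insert by simp
qed simp

lemma prime_dvd_central_binomial:
  assumes "prime p" "n < p" "p \<le> 2 * n"
  shows "p dvd (2 * n choose n)"
proof -
  have "p dvd fact n * fact n * (2 * n choose n)"
    using binomial_fact_lemma[of n "2 * n"] assms
    by (metis add_diff_cancel_right' le_add2 mult_2 prime_dvd_fact_iff)
  then show ?thesis
    using assms by (simp add: prime_dvd_mult_iff prime_dvd_fact_iff)
qed

text \<open>Chebyshev's argument: the primes in the dyadic block are distinct divisors of a central
  binomial coefficient that is at most \<open>2 ^ (2 * 2 ^ j)\<close>, and each of them exceeds
  \<open>2 ^ j\<close>.\<close>

lemma card_primes_dyadic:
  "j * card {p::nat. prime p \<and> 2 ^ j < p \<and> p \<le> 2 ^ Suc j} \<le> 2 * 2 ^ j"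
proof -
  let ?A = "{p::nat. prime p \<and> 2 ^ j < p \<and> p \<le> 2 ^ Suc j}"
  have fin: "finite ?A" by (rule finite_subset[of _ "{..2 ^ Suc j}"]) auto
  have "(2 ^ j) ^ card ?A = (\<Prod>p\<in>?A. (2::nat) ^ j)" by simp
  also have "\<dots> \<le> \<Prod>?A" by (intro prod_mono) auto
  also have "\<dots> \<le> (2 * 2 ^ j choose 2 ^ j)"
  proof (rule dvd_imp_le[OF prod_primes_dvd[OF fin]])
    show "p dvd (2 * 2 ^ j choose 2 ^ j)" if "p \<in> ?A" for p
      using that by (intro prime_dvd_central_binomial) auto
  qed auto
  also have "\<dots> \<le> 2 ^ (2 * 2 ^ j)" by (rule binomial_le_pow2)
  finally have "(2::nat) ^ (j * card ?A) \<le> 2 ^ (2 * 2 ^ j)" by (simp add: power_mult)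
  then show ?thesis by simp
qed

text \<open>The block of primes above \<open>2 ^ j\<close> contributes at most \<open>2 / j\<close>,
  so the blocks build up a harmonic sum, that is, a double logarithm.\<close>

lemma sum_inverse_primes_dyadic:
  "(\<Sum>p | prime p \<and> p \<le> 2 ^ Suc J. 1 / real p) \<le> 1 + 2 * harm J"
proof (induction J)
  case 0
  have "{p::nat. prime p \<and> p \<le> 2} = {2}"
    by (auto dest: prime_ge_2_nat)
  then show ?case by (simp add: harm_def)
next
  case (Suc J)
  let ?j = "Suc J"
  let ?A = "{p::nat. prime p \<and> 2 ^ ?j < p \<and> p \<le> 2 ^ Suc ?j}"
  have fin: "finite ?A" "finite {p::nat. prime p \<and> p \<le> 2 ^ ?j}"
    by (rule finite_subset[OF _ finite_Collect_le_nat[of "2 ^ Suc ?j"]], blast,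
        rule finite_subset[OF _ finite_Collect_le_nat[of "2 ^ ?j"]], blast)
  have "(2::nat) ^ ?j \<le> 2 ^ Suc ?j" by simp
  then have eq: "{p::nat. prime p \<and> p \<le> 2 ^ Suc ?j} = {p. prime p \<and> p \<le> 2 ^ ?j} \<union> ?A"
    unfolding set_eq_iff Un_iff mem_Collect_eq using le_trans not_le by metis
  have "(\<Sum>p\<in>?A. 1 / real p) \<le> (\<Sum>p\<in>?A. 1 / 2 ^ ?j)"
  proof (rule sum_mono)
    fix p assume "p \<in> ?A"
    then have "real (2 ^ ?j) \<le> real p" by (intro of_nat_mono) auto
    moreover have "(2::real) ^ ?j > 0" by (rule zero_less_power) simp
    ultimately show "1 / real p \<le> 1 / 2 ^ ?j"
      unfolding of_nat_power of_nat_numeral by (intro divide_left_mono mult_pos_pos) linarith+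
  qed
  also have "\<dots> = real (card ?A) / 2 ^ ?j" by simp
  also have "\<dots> \<le> 2 / real ?j"
  proof -
    have "real (?j * card ?A) \<le> real (2 * 2 ^ ?j)"
      by (intro of_nat_mono card_primes_dyadic)
    then have "real (card ?A) * real ?j \<le> 2 * 2 ^ ?j" by (simp only: of_nat_mult of_nat_power of_nat_numeral mult.commute)
    moreover have "c / b \<le> 2 / n" if "c * n \<le> 2 * b" "b > 0" "n > 0" for b c n :: real
      using that by (simp add: field_simps)
    ultimately show ?thesis by (metis of_nat_0_less_iff zero_less_Suc zero_less_numeral zero_less_power)
  qed
  finally have "(\<Sum>p\<in>?A. 1 / real p) \<le> 2 / real ?j" .
  moreover have "(\<Sum>p | prime p \<and> p \<le> 2 ^ Suc ?j. 1 / real p) =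
      (\<Sum>p | prime p \<and> p \<le> 2 ^ ?j. 1 / real p) + (\<Sum>p\<in>?A. 1 / real p)"
    unfolding eq by (intro sum.union_disjoint fin) auto
  moreover have "2 / real ?j = 2 * inverse (real ?j)" by (simp only: divide_inverse)
  ultimately show ?case using Suc.IH by (simp only: harm_Suc distrib_left)
qed

text \<open>Mertens' theorem has coefficient 1 in place of 2. The loss is harmless, because this sum
  only enters the constant in the error \<open>k^2 * ln (ln k)\<close>.\<close>

lemma sum_inverse_primes_le:
  obtains C :: real where "C \<ge> 0"
    "\<And>x. x \<ge> 4 \<Longrightarrow> (\<Sum>p | prime p \<and> real p \<le> x. 1 / real p) \<le> C + 2 * ln (ln x)"
proof -
  have ln2: "ln 2 > (0::real)" "ln 2 < (1::real)" using ln_2_less_1 by auto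
  show ?thesis
  proof (rule that[of "3 - 2 * ln (ln 2)"])
    show "3 - 2 * ln (ln 2) \<ge> (0::real)" using ln2 ln_less_zero[of "ln 2"] by linarith
    fix x :: real assume x: "x \<ge> 4"
    \<comment> \<open>Rounding up and subtracting 1 gives both \<open>x \<le> 2 ^ Suc J\<close>,
      which covers the range of primes, and \<open>J \<le> log 2 x\<close>, which bounds the
      harmonic sum.\<close>
    define J where "J = nat (\<lceil>log 2 x\<rceil> - 1)"
    have "log 2 x \<ge> log 2 4" using x by (subst log_le_cancel_iff) auto
    moreover have "log 2 4 = (2::real)" using log_pow_cancel[of "2::real" 2] by simp
    ultimately have l: "log 2 x \<ge> 2" by simp
    have J: "J > 0" "real J \<le> log 2 x" "log 2 x \<le> real (Suc J)"
      using l unfolding J_def by linarith+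
    have x': "x \<le> 2 ^ Suc J"
      using J(3) x log_le_iff[of 2 x "real (Suc J)"] by (simp add: powr_realpow del: of_nat_Suc power_Suc)
    have "(\<Sum>p | prime p \<and> real p \<le> x. 1 / real p) \<le> (\<Sum>p | prime p \<and> p \<le> 2 ^ Suc J. 1 / real p)"
    proof (rule sum_mono2)
      show "finite {p::nat. prime p \<and> p \<le> 2 ^ Suc J}"
        by (rule finite_subset[of _ "{..2 ^ Suc J}"]) auto
      show "{p. prime p \<and> real p \<le> x} \<subseteq> {p. prime p \<and> p \<le> 2 ^ Suc J}"
      proof clarify
        fix p :: nat assume "real p \<le> x"
        with x' have "real p \<le> real (2 ^ Suc J)" by simp
        then show "p \<le> 2 ^ Suc J" by (simp only: of_nat_le_iff)
      qed
    qed auto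
    also have "\<dots> \<le> 1 + 2 * harm J" by (rule sum_inverse_primes_dyadic)
    also have "harm J \<le> 1 + ln (real J)" by (rule harm_bounds[OF J(1)])
    also have "ln (real J) \<le> ln (log 2 x)" using J l by (subst ln_le_cancel_iff) auto
    also have "ln (log 2 x) = ln (ln x) - ln (ln 2)"
      using x ln2 by (simp add: log_def ln_div)
    finally show "(\<Sum>p | prime p \<and> real p \<le> x. 1 / real p) \<le> 3 - 2 * ln (ln 2) + 2 * ln (ln x)"
      by simp
  qed
qed

lemma sum_inverse_sqrt_le: "(\<Sum>n<N. 1 / sqrt (real (Suc n))) \<le> 2 * sqrt (real N)"
proof (induction N)
  case (Suc N)
  define a b where "a = sqrt (real N)" and "b = sqrt (real (Suc N))"
  have b: "b > 0" "a \<ge> 0" "b\<^sup>2 = a\<^sup>2 + 1" by (auto simp: a_def b_def)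
  have "2 * a * b \<le> a\<^sup>2 + b\<^sup>2" by (rule sum_squares_bound)
  then have "2 * a * b + 1 \<le> 2 * b * b" using b by (simp add: power2_eq_square)
  then have "2 * a + 1 / b \<le> 2 * b" using b(1) by (simp add: field_simps)
  then show ?case using Suc.IH by (simp add: a_def b_def)
qed simp

text \<open>The Euler factor of \<open>a(k)\<close> at \<open>p\<close> is \<open>(1 - x) powr k\<^sup>2 * local_series k x\<close> with \<open>x = 1 / p\<close>.\<close>

definition local_coeff :: "real \<Rightarrow> nat \<Rightarrow> real" where
  "local_coeff k m = pochhammer k m / fact m"

definition local_series :: "real \<Rightarrow> real \<Rightarrow> real" where
  "local_series k x = (\<Sum>m. (local_coeff k m)\<^sup>2 * x ^ m)"

lemma local_coeff_eq_Gamma: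
  "k > 0 \<Longrightarrow> local_coeff k m = Gamma (real m + k) / (fact m * Gamma k)"
  unfolding local_coeff_def by (subst pochhammer_Gamma) (auto simp: add_ac elim!: nonpos_Ints_cases)

lemma local_coeff_nonneg: "k > 0 \<Longrightarrow> local_coeff k m \<ge> 0"
  by (simp add: local_coeff_def pochhammer_nonneg)

lemma local_coeff_le_power:
  assumes "k \<ge> 1"
  shows "local_coeff k m \<le> k ^ m"
proof (induction m)
  case (Suc m)
  have "local_coeff k (Suc m) = local_coeff k m * ((k + real m) / real (Suc m))"
    by (simp add: local_coeff_def pochhammer_Suc)
  also have "(k + real m) / real (Suc m) \<le> k"
    using assms mult_right_mono[of 1 k "real m"] by (simp add: field_simps)
  then have "local_coeff k m * ((k + real m) / real (Suc m)) \<le> k ^ m * k"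
    using Suc assms by (intro mult_mono) auto
  finally show ?case by (simp add: mult.commute)
qed (simp add: local_coeff_def)

lemma local_coeff_sums:
  assumes "\<bar>u\<bar> < 1"
  shows "(\<lambda>m. local_coeff k m * u ^ m) sums ((1 - u) powr (- k))"
proof -
  have "(\<lambda>n. ((- k) gchoose n) * (- u) ^ n) sums (1 + (- u)) powr (- k)"
    by (rule gen_binomial_real) (use assms in simp)
  moreover have "((- k) gchoose n) * (- u) ^ n = local_coeff k n * u ^ n" for n
  proof -
    have "(- u) ^ n = (- 1) ^ n * u ^ n" by (rule power_minus)
    then show ?thesis
      by (simp add: local_coeff_def gbinomial_pochhammer flip: power_mult_distrib)
  qed
  ultimately show ?thesis by simp
qed

text \<open>The coefficients without the square are those of \<open>(1 - u) powr (- k)\<close> with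
  \<open>u = sqrt x\<close>. For nonnegative terms the sum of squares is at most the square of the
  sum, which is the upper bound; the lower bound keeps the terms for m = 0 and m = 1.\<close>

lemma local_series_bounds:
  assumes k: "k > 0" and x: "0 \<le> x" "x < 1"
  shows "summable (\<lambda>m. (local_coeff k m)\<^sup>2 * x ^ m)"
    and "local_series k x \<le> (1 - sqrt x) powr (- (2 * k))"
    and "local_series k x \<ge> 1 + k\<^sup>2 * x"
proof -
  define u where "u = sqrt x"
  have u: "0 \<le> u" "u < 1" "u\<^sup>2 = x" using x by (auto simp: u_def)
  define a where "a = (\<lambda>m. local_coeff k m * u ^ m)"
  define s where "s = (1 - u) powr (- k)"
  have a: "a sums s" unfolding a_def s_def by (rule local_coeff_sums) (use u in auto)
  have a0: "a m \<ge> 0" for m unfolding a_def using local_coeff_nonneg[OF k] u by auto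
  have eq: "(local_coeff k m)\<^sup>2 * x ^ m = (a m)\<^sup>2" for m
    by (simp add: a_def power_mult_distrib flip: u(3) power_mult) (simp add: mult.commute)
  have "a m \<le> s" for m
    using sum_le_suminf[of a "{m}"] a a0 by (simp add: sums_iff)
  then have le: "(a m)\<^sup>2 \<le> s * a m" for m
    using a0[of m] by (simp add: power2_eq_square mult_right_mono)
  have sm': "summable (\<lambda>m. s * a m)" using a by (intro summable_mult) (simp add: sums_iff)
  have sm: "summable (\<lambda>m. (a m)\<^sup>2)"
    by (rule summable_comparison_test'[OF sm', of 0]) (use le in auto)
  then show "summable (\<lambda>m. (local_coeff k m)\<^sup>2 * x ^ m)" by (simp add: eq)
  have "local_series k x \<le> (\<Sum>m. s * a m)"
    unfolding local_series_def eq by (intro suminf_le le sm sm')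
  also have "\<dots> = s * s" using a by (subst suminf_mult) (auto simp: sums_iff)
  also have "\<dots> = (1 - u) powr (- (2 * k))" by (simp add: s_def flip: powr_add)
  finally show "local_series k x \<le> (1 - sqrt x) powr (- (2 * k))" by (simp add: u_def)
  have "(\<Sum>m\<in>{0,1}. (a m)\<^sup>2) \<le> local_series k x"
    unfolding local_series_def eq by (intro sum_le_suminf sm) auto
  moreover have "(\<Sum>m\<in>{0,1}. (a m)\<^sup>2) = 1 + k\<^sup>2 * x"
    by (simp add: a_def local_coeff_def power_mult_distrib u)
  ultimately show "local_series k x \<ge> 1 + k\<^sup>2 * x" by simp
qed

lemma local_series_le_geometric:
  assumes k: "k \<ge> 1" and x: "0 \<le> x" "k\<^sup>2 * x < 1"
  shows "local_series k x \<le> 1 / (1 - k\<^sup>2 * x)"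
proof -
  have "x \<le> k\<^sup>2 * x" using mult_right_mono[of 1 "k\<^sup>2" x] k x by simp
  then have x1: "x < 1" using x by simp
  have "(local_coeff k m)\<^sup>2 * x ^ m \<le> (k\<^sup>2 * x) ^ m" for m
  proof -
    have "(local_coeff k m)\<^sup>2 \<le> (k ^ m)\<^sup>2"
      using k by (intro power_mono local_coeff_le_power local_coeff_nonneg) auto
    then have "(local_coeff k m)\<^sup>2 * x ^ m \<le> (k ^ m)\<^sup>2 * x ^ m"
      using x by (intro mult_right_mono) auto
    also have "\<dots> = (k\<^sup>2 * x) ^ m"
      by (simp add: power_mult_distrib mult.commute flip: power_mult)
    finally show ?thesis .
  qed
  then have "local_series k x \<le> (\<Sum>m. (k\<^sup>2 * x) ^ m)"
    unfolding local_series_def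
    using local_series_bounds(1)[of k x] k x x1 by (intro suminf_le summable_geometric) auto
  also have "\<dots> = 1 / (1 - k\<^sup>2 * x)"
    using k x by (intro suminf_geometric) auto
  finally show ?thesis .
qed

lemma ln_one_minus_ge:
  fixes x :: real
  assumes "0 \<le> x" "x < 1"
  shows "ln (1 - x) \<ge> - (x / (1 - x))"
proof -
  have "ln (1 / (1 - x)) \<le> 1 / (1 - x) - 1" using assms by (intro ln_le_minus_one) auto
  also have "\<dots> = x / (1 - x)" using assms by (simp add: field_simps)
  finally show ?thesis using assms by (simp add: ln_div)
qed

definition local_log :: "real \<Rightarrow> real \<Rightarrow> real" where
  "local_log k x = k\<^sup>2 * ln (1 - x) + ln (local_series k x)"

text \<open>Meant for the primes up to about \<open>2 * k^2\<close>: the bound is linear in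
  \<open>k\<close>, and the sum of \<open>1 / sqrt p\<close> over that range is \<open>O(k)\<close>,
  so the total is \<open>O(k^2)\<close>.\<close>

lemma local_log_le_sqrt:
  assumes k: "k > 0" and x: "0 \<le> x" "x \<le> 1/2"
  shows "local_log k x \<le> 8 * k * sqrt x"
proof -
  define u where "u = sqrt x"
  have "u\<^sup>2 \<le> (3/4)\<^sup>2" using x by (simp add: u_def power_divide)
  \<comment> \<open>The value 3/4 is a convenient rational above \<open>sqrt (1/2)\<close>; it gives
    \<open>1 / (1 - u) \<le> 4\<close>.\<close>
  then have u: "0 \<le> u" "u \<le> 3/4" using x by (auto simp: u_def intro: power2_le_imp_le)
  have S: "1 \<le> local_series k x"
  proof -
    have "1 + k\<^sup>2 * x \<ge> 1" using x by simp
    then show ?thesis using local_series_bounds(3)[OF k, of x] x by linarith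
  qed
  have "ln (local_series k x) \<le> ln ((1 - u) powr (- (2 * k)))"
    using local_series_bounds(2)[OF k, of x] x S u by (subst ln_le_cancel_iff) (auto simp: u_def)
  also have "\<dots> = - 2 * k * ln (1 - u)" using u by (simp add: ln_powr)
  also have "\<dots> = 2 * k * (- ln (1 - u))" by simp
  also have "\<dots> \<le> 2 * k * (4 * u)"
  proof -
    have "u / (1 - u) \<le> 4 * u" using u by (cases "u = 0") (auto simp: field_simps)
    then have "- ln (1 - u) \<le> 4 * u" using ln_one_minus_ge[of u] u by linarith
    then show ?thesis using k by (intro mult_left_mono) auto
  qed
  finally have "ln (local_series k x) \<le> 8 * k * u" by simp
  moreover have "k\<^sup>2 * ln (1 - x) \<le> 0" using x by (intro mult_nonneg_nonpos) auto
  ultimately show ?thesis by (simp add: local_log_def u_def)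
qed

text \<open>The series is at least 1, so only the power of \<open>1 - x\<close> can make the factor
  small. Summing \<open>1 / p\<close> over the small primes is what produces
  \<open>ln (ln k)\<close> in the estimate of \<open>a(k)\<close>.\<close>

lemma local_log_ge_linear:
  assumes k: "k > 0" and x: "0 \<le> x" "x \<le> 1/2"
  shows "local_log k x \<ge> - (2 * k\<^sup>2 * x)"
proof -
  have "1 + k\<^sup>2 * x \<ge> 1" using x by simp
  then have "ln (local_series k x) \<ge> 0"
    using local_series_bounds(3)[OF k, of x] x by (intro ln_ge_zero) linarith
  moreover have "k\<^sup>2 * ln (1 - x) \<ge> k\<^sup>2 * (- (2 * x))"
  proof (rule mult_left_mono)
    have "x / (1 - x) \<le> 2 * x" using x by (cases "x = 0") (auto simp: field_simps)
    then show "- (2 * x) \<le> ln (1 - x)" using ln_one_minus_ge[of x] x by linarith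
  qed simp
  ultimately show ?thesis by (simp add: local_log_def)
qed

text \<open>Meant for the large primes: the linear terms \<open>- k^2 * x\<close> and
  \<open>k^2 * x\<close> of the two logarithms cancel. The remaining quadratic error makes the sum
  over primes converge.\<close>

lemma local_log_abs_le:
  assumes k: "k \<ge> 1" and x: "0 \<le> x" "k\<^sup>2 * x \<le> 1/2"
  shows "\<bar>local_log k x\<bar> \<le> 3 * k ^ 4 * x\<^sup>2"
proof -
  define y where "y = k\<^sup>2 * x"
  have xy: "x \<le> y" unfolding y_def using mult_right_mono[of 1 "k\<^sup>2" x] k x by simp
  have y: "0 \<le> y" "y \<le> 1/2" using x by (auto simp: y_def)
  have ysq: "y\<^sup>2 = k ^ 4 * x\<^sup>2" by (simp add: y_def power_mult_distrib)
  have S: "1 + y \<le> local_series k x" "local_series k x \<le> 1 / (1 - y)"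
    using local_series_bounds(3)[of k x] local_series_le_geometric[of k x] k x y xy by (auto simp: y_def)
  have q: "z / (1 - z) \<le> z + 2 * z\<^sup>2" if "0 \<le> z" "z \<le> 1/2" for z :: real
  proof -
    have "(z + 2 * z\<^sup>2) * (1 - z) - z = z\<^sup>2 * (1 - 2 * z)" by (simp add: algebra_simps power2_eq_square)
    moreover have "\<dots> \<ge> 0" using that by auto
    ultimately have "z \<le> (z + 2 * z\<^sup>2) * (1 - z)" by linarith
    then show ?thesis using that by (simp add: pos_divide_le_eq)
  qed
  have "ln (local_series k x) \<le> ln (1 / (1 - y))"
    using S y by (subst ln_le_cancel_iff) auto
  also have "\<dots> = - ln (1 - y)" using y by (simp add: ln_div)
  also have "\<dots> \<le> y + 2 * y\<^sup>2" using ln_one_minus_ge[of y] q[of y] y by linarith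
  finally have up: "ln (local_series k x) \<le> y + 2 * y\<^sup>2" .
  have "ln (1 + y) \<le> ln (local_series k x)" using S y by (subst ln_le_cancel_iff) auto
  then have lo: "y - y\<^sup>2 / 2 \<le> ln (local_series k x)" using ln_one_plus_bounds(1)[OF y(1)] by linarith
  have "k\<^sup>2 * ln (1 - x) \<le> k\<^sup>2 * (- x)"
    using ln_le_minus_one[of "1 - x"] x xy y by (intro mult_left_mono) auto
  then have up': "k\<^sup>2 * ln (1 - x) \<le> - y" by (simp add: y_def)
  have "k\<^sup>2 * (- (x + 2 * x\<^sup>2)) \<le> k\<^sup>2 * ln (1 - x)"
    using ln_one_minus_ge[of x] q[of x] x xy y by (intro mult_left_mono) auto
  moreover have "k\<^sup>2 * x\<^sup>2 \<le> y\<^sup>2"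
    unfolding ysq using k by (intro mult_right_mono power_increasing) auto
  ultimately have lo': "- y - 2 * y\<^sup>2 \<le> k\<^sup>2 * ln (1 - x)" by (simp add: y_def algebra_simps)
  have "y\<^sup>2 \<ge> 0" by simp
  then have "\<bar>local_log k x\<bar> \<le> 3 * y\<^sup>2"
    using up up' lo lo' unfolding local_log_def abs_le_iff by (intro conjI) linarith+
  then show ?thesis by (simp add: ysq)
qed

text \<open>The value 0 off the primes matches the factor 1 in \<open>arith_factor\<close>, so the
  Euler product becomes the exponential of a series over all natural numbers.\<close>

definition prime_log :: "real \<Rightarrow> nat \<Rightarrow> real" where
  "prime_log k n = (if prime n then local_log k (1 / real n) else 0)"

lemma prime_inverse_le_half: "prime p \<Longrightarrow> 1 / real p \<le> 1/2"
  using prime_ge_2_nat[of p] by (simp add: field_simps)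

lemma exp_prime_log:
  assumes k: "k > 0" and p: "prime p"
  shows "exp (prime_log k p) = (1 - 1 / real p) powr k\<^sup>2 *
            (\<Sum>m. (Gamma (real m + k) / (fact m * Gamma k))\<^sup>2 / real p ^ m)"
proof -
  have x: "0 \<le> 1 / real p" "1 / real p \<le> 1/2" using prime_inverse_le_half[OF p] by auto
  have "1 + k\<^sup>2 * (1 / real p) \<ge> 1" by simp
  then have "local_series k (1 / real p) > 0"
    using local_series_bounds(3)[OF k, of "1 / real p"] x by linarith
  then have "exp (prime_log k p) = exp (k\<^sup>2 * ln (1 - 1 / real p)) * local_series k (1 / real p)"
    using p by (simp add: prime_log_def local_log_def exp_add)
  also have "exp (k\<^sup>2 * ln (1 - 1 / real p)) = (1 - 1 / real p) powr k\<^sup>2"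
  proof -
    have "1 - 1 / real p \<noteq> 0" using x by linarith
    then show ?thesis by (metis powr_def)
  qed
  also have "local_series k (1 / real p) = (\<Sum>m. (Gamma (real m + k) / (fact m * Gamma k))\<^sup>2 / real p ^ m)"
    by (simp add: local_series_def local_coeff_eq_Gamma[OF k] power_divide)
  finally show ?thesis .
qed

lemma abs_prime_log_le:
  assumes "k \<ge> 1" "real n \<ge> 2 * k\<^sup>2"
  shows "\<bar>prime_log k n\<bar> \<le> 3 * k ^ 4 * (1 / (real n)\<^sup>2)"
proof (cases "prime n")
  case True
  then have "real n > 0" by (simp add: prime_gt_0_nat)
  then have "k\<^sup>2 * (1 / real n) \<le> 1/2" using assms by (simp add: field_simps)
  then show ?thesis
    using local_log_abs_le[of k "1 / real n"] True assms by (simp add: prime_log_def power_divide)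
qed (use assms in \<open>simp add: prime_log_def\<close>)

lemma prime_log_summable:
  assumes "k \<ge> 1"
  shows "summable (prime_log k)"
proof -
  have "summable (\<lambda>n. 1 / (real (Suc n))\<^sup>2)"
    using inverse_square_tail(1)[of 1] summable_iff_shift[of "\<lambda>n. 1 / (real (Suc n))\<^sup>2" 1] by simp
  then have "summable (\<lambda>n. 1 / (real n)\<^sup>2)" by (simp only: summable_Suc_iff[of "\<lambda>n. 1 / (real n)\<^sup>2"])
  then have sm: "summable (\<lambda>n. 3 * k ^ 4 * (1 / (real n)\<^sup>2))" by (rule summable_mult)
  show ?thesis
  proof (rule summable_comparison_test'[OF sm, of "nat \<lceil>2 * k\<^sup>2\<rceil>"])
    fix n assume "n \<ge> nat \<lceil>2 * k\<^sup>2\<rceil>"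
    then have "real n \<ge> 2 * k\<^sup>2" by linarith
    then show "norm (prime_log k n) \<le> 3 * k ^ 4 * (1 / (real n)\<^sup>2)"
      using abs_prime_log_le[OF assms] by simp
  qed
qed

lemma arith_factor_eq_exp:
  assumes "k \<ge> 1"
  shows "arith_factor k = exp (\<Sum>n. prime_log k n)"
proof -
  have "(if prime p then (1 - 1 / real p) powr k\<^sup>2 *
            (\<Sum>m. (Gamma (real m + k) / (fact m * Gamma k))\<^sup>2 / real p ^ m) else 1) = exp (prime_log k p)" for p
    using exp_prime_log[of k p] assms by (simp add: prime_log_def)
  then show ?thesis
    unfolding arith_factor_def by (simp only: prodinf_exp[OF prime_log_summable[OF assms]])
qed

text \<open>Primes above \<open>2 * k^2\<close> contribute \<open>O(k^4 / k^2)\<close> by the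
  quadratic estimate. Below that, the upper and the lower estimate of the local factor differ in
  kind: the former sums to \<open>O(k^2)\<close>, the latter to
  \<open>O(k^2 * (1 + ln (ln k)))\<close>.\<close>

lemma arith_factor_bound:
  obtains C :: real where "C \<ge> 0"
    "\<And>k. k \<ge> 3 \<Longrightarrow> arith_factor k > 0 \<and> \<bar>ln (arith_factor k)\<bar> \<le> C * k\<^sup>2 * (1 + ln (ln k))"
proof -
  obtain C :: real where C: "C \<ge> 0"
    "\<And>x. x \<ge> 4 \<Longrightarrow> (\<Sum>p | prime p \<and> real p \<le> x. 1 / real p) \<le> C + 2 * ln (ln x)"
    using sum_inverse_primes_le by blast
  show ?thesis
  proof (rule that[of "40 + 2 * C"])
    show "40 + 2 * C \<ge> 0" using C by simp
    fix k :: real assume k: "k \<ge> 3"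
    \<comment> \<open>From here on \<open>k^2 / p \<le> 1/2\<close>, the range of the quadratic
      estimate.\<close>
    define N where "N = nat \<lceil>2 * k\<^sup>2\<rceil>"
    have k2: "9 \<le> k\<^sup>2" using power_mono[of 3 k 2] k by simp
    have N: "N > 0" "real N \<ge> 2 * k\<^sup>2" "real N \<le> 3 * k\<^sup>2" using k2 unfolding N_def by linarith+
    have lnk: "ln k \<ge> 1" using k exp_le ln_ge_iff[of k 1] by linarith
    then have lnlnk: "ln (ln k) \<ge> 0" by simp
    define P where "P = {p. prime p \<and> p \<le> N}"
    have finP: "finite P" unfolding P_def by (rule finite_subset[of _ "{..N}"]) auto
    have "(\<Sum>n. prime_log k n) = (\<Sum>n. prime_log k (n + Suc N)) + (\<Sum>n<Suc N. prime_log k n)"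
      using k by (intro suminf_split_initial_segment prime_log_summable) auto
    also have "(\<Sum>n<Suc N. prime_log k n) = (\<Sum>p\<in>P. local_log k (1 / real p))"
      by (intro sum.mono_neutral_cong_right) (auto simp: P_def prime_log_def)
    finally have split: "(\<Sum>n. prime_log k n) =
      (\<Sum>n. prime_log k (n + Suc N)) + (\<Sum>p\<in>P. local_log k (1 / real p))" .
    have sm2: "summable (\<lambda>n. 3 * k ^ 4 * (1 / (real (Suc (n + N)))\<^sup>2))"
      by (intro summable_mult inverse_square_tail N)
    have le: "norm (prime_log k (n + Suc N)) \<le> 3 * k ^ 4 * (1 / (real (Suc (n + N)))\<^sup>2)" for n
      using abs_prime_log_le[of k "Suc (n + N)"] k N by simp
    have "\<bar>\<Sum>n. prime_log k (n + Suc N)\<bar> \<le> (\<Sum>n. 3 * k ^ 4 * (1 / (real (Suc (n + N)))\<^sup>2))"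
      using norm_suminf_le[OF le sm2] by (simp only: real_norm_def)
    also have "\<dots> = 3 * k ^ 4 * (\<Sum>n. 1 / (real (Suc (n + N)))\<^sup>2)"
      by (intro suminf_mult inverse_square_tail N)
    also have "\<dots> \<le> 3 * k ^ 4 * (1 / real N)"
      by (intro mult_left_mono inverse_square_tail N) auto
    also have "\<dots> \<le> 3 * k ^ 4 * (1 / (2 * k\<^sup>2))"
      using N k k2 by (intro mult_left_mono divide_left_mono) auto
    also have "\<dots> \<le> 2 * k\<^sup>2"
      using k by (simp add: power4_eq_xxxx power2_eq_square)
    finally have tail: "\<bar>\<Sum>n. prime_log k (n + Suc N)\<bar> \<le> 2 * k\<^sup>2" .
    have up: "(\<Sum>p\<in>P. local_log k (1 / real p)) \<le> 32 * k\<^sup>2"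
    proof -
      have "(\<Sum>p\<in>P. local_log k (1 / real p)) \<le> (\<Sum>p\<in>P. 8 * k * (1 / sqrt (real p)))"
      proof (rule sum_mono)
        fix p assume "p \<in> P"
        then show "local_log k (1 / real p) \<le> 8 * k * (1 / sqrt (real p))"
          using local_log_le_sqrt[of k "1 / real p"] k prime_inverse_le_half[of p]
          by (simp add: P_def real_sqrt_divide)
      qed
      also have "\<dots> = 8 * k * (\<Sum>p\<in>P. 1 / sqrt (real p))" by (simp only: sum_distrib_left)
      \<comment> \<open>Enlarging the primes to all integers up to \<open>N\<close> still leaves a
        sum of order \<open>sqrt N\<close>, hence of order \<open>k\<close>.\<close>
      also have "(\<Sum>p\<in>P. 1 / sqrt (real p)) \<le> (\<Sum>p\<in>{1..N}. 1 / sqrt (real p))"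
        by (intro sum_mono2) (auto simp: P_def dest: prime_ge_1_nat)
      also have "\<dots> = (\<Sum>n<N. 1 / sqrt (real (Suc n)))"
        by (rule sum.reindex_bij_witness[of _ Suc "\<lambda>n. n - 1"]) auto
      also have "\<dots> \<le> 2 * sqrt (real N)" by (rule sum_inverse_sqrt_le)
      also have "sqrt (real N) \<le> sqrt ((2 * k)\<^sup>2)"
        using N k by (intro real_sqrt_le_mono) (simp add: power_mult_distrib)
      also have "sqrt ((2 * k)\<^sup>2) = 2 * k" using k by (subst real_sqrt_abs) simp
      finally show ?thesis using k by (simp add: power2_eq_square)
    qed
    have lo: "(\<Sum>p\<in>P. local_log k (1 / real p)) \<ge> - (2 * k\<^sup>2 * (C + 4 + 2 * ln (ln k)))"
    proof -
      have "(\<Sum>p\<in>P. 1 / real p) \<le> (\<Sum>p | prime p \<and> real p \<le> k ^ 4. 1 / real p)"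
      proof (rule sum_mono2)
        show "finite {p. prime p \<and> real p \<le> k ^ 4}"
          by (rule finite_subset[of _ "{..nat \<lfloor>k ^ 4\<rfloor>}"]) (auto simp: le_nat_floor)
        \<comment> \<open>The generous cutoff \<open>k ^ 4\<close> costs only the constant
          \<open>ln 4\<close> inside the double logarithm.\<close>
        have "3 * k\<^sup>2 \<le> k ^ 4" using mult_right_mono[of 3 "k\<^sup>2" "k\<^sup>2"] k2
          by (simp add: power4_eq_xxxx power2_eq_square mult_ac)
        then show "P \<subseteq> {p. prime p \<and> real p \<le> k ^ 4}" using N by (auto simp: P_def)
      qed auto
      also have "\<dots> \<le> C + 2 * ln (ln (k ^ 4))"
        using power_mono[of 3 k 4] k by (intro C) auto
      also have "ln (ln (k ^ 4)) = ln 4 + ln (ln k)"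
        using k lnk by (simp add: ln_realpow ln_mult)
      also have "ln 4 \<le> (2::real)"
        using ln_2_less_1 ln_mult[of 2 "2::real"] by simp
      finally have S: "(\<Sum>p\<in>P. 1 / real p) \<le> C + 4 + 2 * ln (ln k)" by simp
      have "- (2 * k\<^sup>2 * (C + 4 + 2 * ln (ln k))) \<le> - (2 * k\<^sup>2 * (\<Sum>p\<in>P. 1 / real p))"
        using S by (simp add: mult_left_mono)
      also have "\<dots> = (\<Sum>p\<in>P. - (2 * k\<^sup>2 * (1 / real p)))"
        by (simp only: sum_negf sum_distrib_left)
      also have "\<dots> \<le> (\<Sum>p\<in>P. local_log k (1 / real p))"
      proof (rule sum_mono)
        fix p assume "p \<in> P"
        then show "- (2 * k\<^sup>2 * (1 / real p)) \<le> local_log k (1 / real p)"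
          using local_log_ge_linear[of k "1 / real p"] k prime_inverse_le_half[of p] by (simp add: P_def)
      qed
      finally show ?thesis .
    qed
    have nn: "k\<^sup>2 * ln (ln k) \<ge> 0" "C * (k\<^sup>2 * ln (ln k)) \<ge> 0" "C * k\<^sup>2 \<ge> 0" "k\<^sup>2 \<ge> 0" using lnlnk C by auto
    have e1: "2 * k\<^sup>2 * (C + 4 + 2 * ln (ln k)) = 2 * (C * k\<^sup>2) + 8 * k\<^sup>2 + 4 * (k\<^sup>2 * ln (ln k))"
      "(40 + 2 * C) * k\<^sup>2 * (1 + ln (ln k)) =
         40 * k\<^sup>2 + 40 * (k\<^sup>2 * ln (ln k)) + 2 * (C * k\<^sup>2) + 2 * (C * (k\<^sup>2 * ln (ln k)))"
      by (simp_all add: algebra_simps)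
    have "\<bar>\<Sum>n. prime_log k n\<bar> \<le> (40 + 2 * C) * k\<^sup>2 * (1 + ln (ln k))"
      using tail up lo nn unfolding split e1 abs_le_iff by (intro conjI) linarith+
    then show "arith_factor k > 0 \<and> \<bar>ln (arith_factor k)\<bar> \<le> (40 + 2 * C) * k\<^sup>2 * (1 + ln (ln k))"
      using k by (simp add: arith_factor_eq_exp)
  qed
qed

section \<open>Moments and maxima\<close>

definition moment_const :: "real \<Rightarrow> real" where
  "moment_const k = (Barnes_G (k + 1))\<^sup>2 / Barnes_G (2 * k + 1) * arith_factor k"

text \<open>The main terms of the Barnes functions combine to
  \<open>k^2 * ln k - 2 * k^2 * ln (2 * k)\<close>, that is
  \<open>- k^2 * ln k - 2 * k^2 * ln 2\<close>; everything else is error.\<close>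

lemma ln_moment_const:
  obtains C :: real where "C \<ge> 0"
    "\<And>k. k \<ge> 3 \<Longrightarrow> moment_const k > 0 \<and> \<bar>ln (moment_const k) + k\<^sup>2 * ln k\<bar> \<le> C * k\<^sup>2 * (1 + ln (ln k))"
proof -
  obtain A :: real where A: "A \<ge> 0" "\<And>w. w \<ge> 1 \<Longrightarrow> \<bar>ln (Barnes_G (w + 1)) - w\<^sup>2 / 2 * ln w\<bar> \<le> A * w\<^sup>2"
    using Barnes_G_asymp by blast
  obtain B :: real where B: "B \<ge> 0"
    "\<And>k. k \<ge> 3 \<Longrightarrow> arith_factor k > 0 \<and> \<bar>ln (arith_factor k)\<bar> \<le> B * k\<^sup>2 * (1 + ln (ln k))"
    using arith_factor_bound by blast
  show ?thesis
  proof (rule that[of "6 * A + 2 + B"])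
    show "6 * A + 2 + B \<ge> 0" using A B by simp
    fix k :: real assume k: "k \<ge> 3"
    have pos: "Barnes_G (k + 1) > 0" "Barnes_G (2 * k + 1) > 0" "arith_factor k > 0"
      using k B by (auto intro: Barnes_G_pos)
    have lnk: "ln k \<ge> 1" using k exp_le ln_ge_iff[of k 1] by linarith
    then have lnlnk: "ln (ln k) \<ge> 0" by simp
    have ln_eq: "ln (moment_const k) = 2 * ln (Barnes_G (k + 1)) - ln (Barnes_G (2 * k + 1)) + ln (arith_factor k)"
      unfolding moment_const_def using pos by (simp add: ln_mult ln_div ln_realpow)
    define u v w where "u = ln (Barnes_G (k + 1)) - k\<^sup>2 / 2 * ln k"
      and "v = ln (Barnes_G (2 * k + 1)) - (2 * k)\<^sup>2 / 2 * ln (2 * k)"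
      and "w = ln (arith_factor k)"
    have u: "\<bar>u\<bar> \<le> A * k\<^sup>2" unfolding u_def using A(2)[of k] k by simp
    have v: "\<bar>v\<bar> \<le> 4 * (A * k\<^sup>2)" unfolding v_def using A(2)[of "2 * k"] k by simp
    have w: "\<bar>w\<bar> \<le> B * k\<^sup>2 * (1 + ln (ln k))" unfolding w_def using B(2)[OF k] by simp
    have "ln (2 * k) = ln 2 + ln k" using k by (simp add: ln_mult)
    then have "ln (moment_const k) + k\<^sup>2 * ln k = 2 * u - v + w - 2 * (k\<^sup>2 * ln 2)"
      unfolding ln_eq u_def v_def w_def by (simp add: power_mult_distrib algebra_simps)
    moreover have "k\<^sup>2 * ln 2 \<le> k\<^sup>2 * 1" using ln_2_less_1 by (intro mult_left_mono) auto
    moreover have "k\<^sup>2 * ln 2 \<ge> 0" by simp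
    ultimately have "\<bar>ln (moment_const k) + k\<^sup>2 * ln k\<bar> \<le> 6 * (A * k\<^sup>2) + 2 * k\<^sup>2 + B * k\<^sup>2 * (1 + ln (ln k))"
      using u v w by linarith
    also have "\<dots> = (6 * A + 2) * k\<^sup>2 * 1 + B * k\<^sup>2 * (1 + ln (ln k))" by (simp add: algebra_simps)
    also have "\<dots> \<le> (6 * A + 2) * k\<^sup>2 * (1 + ln (ln k)) + B * k\<^sup>2 * (1 + ln (ln k))"
      using A lnlnk by (intro add_right_mono mult_left_mono) auto
    also have "\<dots> = (6 * A + 2 + B) * k\<^sup>2 * (1 + ln (ln k))" by (simp add: algebra_simps)
    finally show "moment_const k > 0 \<and> \<bar>ln (moment_const k) + k\<^sup>2 * ln k\<bar> \<le> (6 * A + 2 + B) * k\<^sup>2 * (1 + ln (ln k))"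
      using pos by (simp add: moment_const_def)
  qed
qed

definition zeta_moment :: "real \<Rightarrow> real \<Rightarrow> real" where
  "zeta_moment k T = 1 / T * integral {0..T} (\<lambda>t. norm (zeta (Complex (1/2) t)) powr (2 * k))"

text \<open>Eventually the ratio of the two sides lies between 1/2 and 2, so their logarithms differ
  by at most \<open>ln 2\<close>. This is absorbed by raising \<open>C\<close> by 1, since
  \<open>k^2 * (1 + ln (ln k))\<close> is at least 1.\<close>

lemma ln_zeta_moment:
  assumes mf: "moment_formula k" and k: "filterlim k at_top at_top"
  obtains C :: real where "C \<ge> 0"
    "eventually (\<lambda>T. zeta_moment (k T) T > 0 \<and>
       \<bar>ln (zeta_moment (k T) T) - (k T)\<^sup>2 * (ln (ln T) - ln (k T))\<bar> \<le> C * (k T)\<^sup>2 * (1 + ln (ln (k T)))) at_top"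
proof -
  obtain C :: real where C: "C \<ge> 0"
    "\<And>k. k \<ge> 3 \<Longrightarrow> moment_const k > 0 \<and> \<bar>ln (moment_const k) + k\<^sup>2 * ln k\<bar> \<le> C * k\<^sup>2 * (1 + ln (ln k))"
    using ln_moment_const by blast
  define g where "g = (\<lambda>T. moment_const (k T) * ln T powr (k T)\<^sup>2)"
  define f where "f = (\<lambda>T. zeta_moment (k T) T)"
  have "f \<sim>[at_top] g"
    using mf unfolding moment_formula_def f_def g_def zeta_moment_def moment_const_def .
  \<comment> \<open>Asymptotic equivalence counts 0/0 as 1; that case is ruled out below by
    \<open>g T > 0\<close>.\<close>
  then have lim: "((\<lambda>T. if f T = 0 \<and> g T = 0 then 1 else f T / g T) \<longlongrightarrow> 1) at_top"
    by (simp add: asymp_equiv_def)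
  have ev: "eventually (\<lambda>T. (if f T = 0 \<and> g T = 0 then 1 else f T / g T) > 1/2) at_top"
    "eventually (\<lambda>T. (if f T = 0 \<and> g T = 0 then 1 else f T / g T) < 2) at_top"
    by (rule order_tendstoD[OF lim], simp)+
  have k3: "eventually (\<lambda>T. k T \<ge> 3) at_top" using k by (simp add: filterlim_at_top)
  have "eventually (\<lambda>T::real. T > exp 1) at_top" by (rule eventually_gt_at_top)
  with ev k3 have "eventually (\<lambda>T. f T > 0 \<and>
       \<bar>ln (f T) - (k T)\<^sup>2 * (ln (ln T) - ln (k T))\<bar> \<le> (C + 1) * (k T)\<^sup>2 * (1 + ln (ln (k T)))) at_top"
  proof eventually_elim
    case (elim T)
    have "T > 0" using elim exp_gt_zero[of 1] by linarith
    then have lnT: "ln T > 1" using elim by (metis exp_less_cancel_iff exp_ln)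
    have lnk: "ln (k T) \<ge> 1" using elim(3) exp_le ln_ge_iff[of "k T" 1] by linarith
    then have lnlnk: "ln (ln (k T)) \<ge> 0" by simp
    have mc: "moment_const (k T) > 0" using C(2)[OF elim(3)] by auto
    then have g: "g T > 0" using lnT by (simp add: g_def)
    then have q: "f T / g T > 1/2" "f T / g T < 2" using elim by auto
    then have f: "f T > 0" using g by (simp add: field_simps)
    have "ln (1/2) \<le> ln (f T / g T)" "ln (f T / g T) \<le> ln 2"
      using q f g by (subst ln_le_cancel_iff; simp)+
    then have "\<bar>ln (f T) - ln (g T)\<bar> \<le> ln 2" using f g by (simp add: ln_div abs_le_iff)
    moreover have "ln 2 \<le> (1::real)" using ln_2_less_1 by linarith
    moreover have "ln (g T) = ln (moment_const (k T)) + (k T)\<^sup>2 * ln (ln T)"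
      using mc lnT by (simp add: g_def ln_mult ln_powr)
    moreover have "\<bar>ln (moment_const (k T)) + (k T)\<^sup>2 * ln (k T)\<bar> \<le> C * (k T)\<^sup>2 * (1 + ln (ln (k T)))"
      using C(2)[OF elim(3)] by auto
    moreover have "(k T)\<^sup>2 * (ln (ln T) - ln (k T)) = (k T)\<^sup>2 * ln (ln T) - (k T)\<^sup>2 * ln (k T)"
      by (simp add: right_diff_distrib)
    moreover have "1 * 1 \<le> (k T)\<^sup>2 * (1 + ln (ln (k T)))"
      using elim(3) lnlnk by (intro mult_mono) (auto simp: one_le_power)
    moreover have "(C + 1) * (k T)\<^sup>2 * (1 + ln (ln (k T))) = C * (k T)\<^sup>2 * (1 + ln (ln (k T))) + (k T)\<^sup>2 * (1 + ln (ln (k T)))"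
      by (simp add: algebra_simps)
    ultimately have "\<bar>ln (f T) - (k T)\<^sup>2 * (ln (ln T) - ln (k T))\<bar> \<le> (C + 1) * (k T)\<^sup>2 * (1 + ln (ln (k T)))"
      by linarith
    with f show ?case by blast
  qed
  then show ?thesis using C(1) unfolding f_def by (intro that[of "C + 1"]) auto
qed

lemma zeta_power_integrable:
  assumes "k > 0"
  shows "(\<lambda>t. norm (zeta (Complex (1/2) t)) powr (2 * k)) integrable_on {a..b}"
  by (intro integrable_continuous_real continuous_on_powr' continuous_intros zeta_critical_line_continuous)
     (use assms in auto)

lemma zeta_moment_le:
  assumes "k > 0" "T > 0"
  shows "zeta_moment k T \<le> zeta_max T powr (2 * k)"
proof -
  have "integral {0..T} (\<lambda>t. norm (zeta (Complex (1/2) t)) powr (2 * k)) \<le>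
        integral {0..T} (\<lambda>t. zeta_max T powr (2 * k))"
    using assms by (intro integral_le zeta_power_integrable powr_mono2 norm_zeta_le_zeta_max) auto
  also have "\<dots> = T * zeta_max T powr (2 * k)" using assms by simp
  finally show ?thesis using assms by (simp add: zeta_moment_def field_simps)
qed

lemma zeta_max_lower:
  assumes "k > 0" "T > 0" "zeta_moment k T > 0"
  shows "zeta_max T > 0" "ln (zeta_moment k T) \<le> 2 * k * ln (zeta_max T)"
proof -
  have le: "zeta_moment k T \<le> zeta_max T powr (2 * k)" using assms by (intro zeta_moment_le)
  have "zeta_max T \<noteq> 0"
  proof
    assume "zeta_max T = 0"
    with le assms show False by simp
  qed
  with zeta_max_nonneg[of T] assms show pos: "zeta_max T > 0" by simp
  have "ln (zeta_moment k T) \<le> ln (zeta_max T powr (2 * k))"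
    using le assms pos by (subst ln_le_cancel_iff) auto
  then show "ln (zeta_moment k T) \<le> 2 * k * ln (zeta_max T)" using pos by (simp add: ln_powr)
qed

text \<open>The derivative bound \<open>D\<close> is available only from height
  \<open>2 * ln T\<close> on. The condition \<open>zeta_max T > C * ln T\<close> forces the maximum
  to occur high enough for the interval to the left of its location to lie in that range.\<close>

lemma zeta_max_upper:
  obtains C :: real where "C \<ge> 1"
    "\<And>k T D. k > 0 \<Longrightarrow> T \<ge> exp 1 \<Longrightarrow> D \<ge> 1 \<Longrightarrow> zeta_max T > C * ln T \<Longrightarrow>
       (\<And>t. t \<in> {2 * ln T..T} \<Longrightarrow> norm (deriv zeta (Complex (1/2) t)) \<le> D) \<Longrightarrow>
       zeta_moment k T > 0 \<and>
       2 * k * (ln (zeta_max T) - ln 2) \<le> ln (2 * D) + ln T + ln (zeta_moment k T)"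
proof -
  obtain C where C: "C \<ge> 1"
    "\<And>t T. T \<ge> 1 \<Longrightarrow> t \<in> {0..T} \<Longrightarrow> norm (zeta (Complex (1/2) t)) \<le> C * T"
    by (rule zeta_strip_bound) blast
  show ?thesis
  proof (rule that[of "3 * C"])
    show "3 * C \<ge> 1" using C by simp
    fix k T D :: real
    assume k: "k > 0" and T: "T \<ge> exp 1" and D: "D \<ge> 1" and big: "zeta_max T > 3 * C * ln T"
      and deriv: "\<And>t. t \<in> {2 * ln T..T} \<Longrightarrow> norm (deriv zeta (Complex (1/2) t)) \<le> D"
    have T0: "T > 0" using T exp_gt_zero[of 1] by linarith
    have L: "ln T \<ge> 1" using T T0 by (simp add: ln_ge_iff)
    obtain t0 where t0: "t0 \<in> {0..T}" "zeta_max T = norm (zeta (Complex (1/2) t0))"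
      using zeta_max_attained[of T] T0 by auto
    define m where "m = zeta_max T"
    have "1 * 1 \<le> 3 * C * ln T" using C L by (intro mult_mono) auto
    then have m1: "m > 1" using big by (simp add: m_def)
    \<comment> \<open>At heights up to \<open>2 * ln T + 1\<close> the linear growth bound keeps
      zeta below \<open>3 * C * ln T\<close>. The extra 1 leaves room for the interval of length
      \<open>r\<close>.\<close>
    have t0_big: "t0 > 2 * ln T + 1"
    proof (rule ccontr)
      assume "\<not> ?thesis"
      then have "m \<le> C * (2 * ln T + 1)"
        unfolding m_def t0(2) using t0(1) L by (intro C) auto
      also have "\<dots> \<le> C * (3 * ln T)" using C L by (intro mult_left_mono) auto
      finally show False using big by (simp add: m_def)
    qed
    \<comment> \<open>Over this length zeta changes by at most \<open>D * r = 1/2\<close>, which is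
      less than half of \<open>m\<close> because \<open>m > 1\<close>.\<close>
    define r where "r = 1 / (2 * D)"
    have r: "0 < r" "r \<le> 1/2" "D * r = 1/2" using D by (auto simp: r_def divide_simps)
    have ge: "norm (zeta (Complex (1/2) t)) \<ge> m / 2" if t: "t \<in> {t0 - r..t0}" for t
    proof -
      let ?S = "closed_segment (Complex (1/2) t) (Complex (1/2) t0)"
      have S: "z = Complex (1/2) (Im z) \<and> Im z \<in> {t..t0}" if "z \<in> ?S" for z
        using that t by (auto simp: closed_segment_same_Re closed_segment_eq_real_ivl complex_eq_iff)
      have "norm (zeta (Complex (1/2) t) - zeta (Complex (1/2) t0)) \<le>
              D * norm (Complex (1/2) t - Complex (1/2) t0)"
      proof (rule field_differentiable_bound[of ?S zeta "deriv zeta"])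
        fix z assume z: "z \<in> ?S"
        have "z \<noteq> 1" using S[OF z] by (auto simp: complex_eq_iff)
        then show "(zeta has_field_derivative deriv zeta z) (at z within ?S)"
          by (intro holomorphic_derivI[OF zeta_holomorphic]) auto
        have "norm (deriv zeta (Complex (1/2) (Im z))) \<le> D"
          using S[OF z] t t0 t0_big r by (intro deriv) auto
        then show "norm (deriv zeta z) \<le> D" using S[OF z] by metis
      qed auto
      also have "Complex (1/2) t - Complex (1/2) t0 = Complex 0 (t - t0)" by (simp add: complex_eq_iff)
      also have "norm (Complex 0 (t - t0)) = \<bar>t - t0\<bar>" by (simp add: cmod_def)
      also have "D * \<bar>t - t0\<bar> \<le> D * r" using t D by (intro mult_left_mono) auto
      finally have "norm (zeta (Complex (1/2) t) - zeta (Complex (1/2) t0)) \<le> 1/2" using r by simp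
      then have "norm (zeta (Complex (1/2) t)) \<ge> m - 1/2"
        using norm_triangle_ineq2[of "zeta (Complex (1/2) t0)" "zeta (Complex (1/2) t)"]
        by (simp add: m_def t0(2) norm_minus_commute)
      then show ?thesis using m1 by simp
    qed
    let ?f = "\<lambda>t. norm (zeta (Complex (1/2) t)) powr (2 * k)"
    have "r * (m / 2) powr (2 * k) = integral {t0 - r..t0} (\<lambda>t. (m / 2) powr (2 * k))"
      using r by simp
    also have "\<dots> \<le> integral {t0 - r..t0} ?f"
      using k m1 by (intro integral_le zeta_power_integrable powr_mono2 ge) auto
    also have "\<dots> \<le> integral {0..T} ?f"
      using t0 t0_big L r k by (intro integral_subset_le zeta_power_integrable) auto
    also have "\<dots> = T * zeta_moment k T" using T0 by (simp add: zeta_moment_def)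
    finally have le: "r * (m / 2) powr (2 * k) \<le> T * zeta_moment k T" .
    have pos: "r * (m / 2) powr (2 * k) > 0" using r m1 by simp
    then have zm: "zeta_moment k T > 0" using le T0 zero_less_mult_pos less_le_trans by blast
    have "ln (r * (m / 2) powr (2 * k)) \<le> ln (T * zeta_moment k T)"
      using le pos zm T0 by (subst ln_le_cancel_iff) auto
    then have "ln r + 2 * k * ln (m / 2) \<le> ln T + ln (zeta_moment k T)"
      using r m1 zm T0 by (simp add: ln_mult ln_powr)
    moreover have "ln r = - ln (2 * D)" using D by (simp add: r_def ln_div)
    moreover have "ln (m / 2) = ln m - ln 2" using m1 by (simp add: ln_div)
    ultimately have "2 * k * (ln m - ln 2) \<le> ln (2 * D) + ln T + ln (zeta_moment k T)" by simp
    with zm show "zeta_moment k T > 0 \<and>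
       2 * k * (ln (zeta_max T) - ln 2) \<le> ln (2 * D) + ln T + ln (zeta_moment k T)"
      by (simp add: m_def)
  qed
qed

section \<open>Comparison of the exponents, with x standing for ln T\<close>

text \<open>The leading term \<open>x / (2 * x powr \<delta>)\<close> is only half of the right-hand
  side. The others have orders \<open>x powr (1 - 2 * \<delta>)\<close> and
  \<open>x powr \<delta> * ln x\<close> or less, which is smaller as
  \<open>0 < \<delta> < 1/2\<close>.\<close>

lemma upper_exponent_power:
  fixes \<delta> C :: real
  assumes "0 < \<delta>" "\<delta> < 1/2"
  shows "eventually (\<lambda>x. ln 2 + (x + C * ln x + C * (x / x powr \<delta>) + (x powr \<delta>)\<^sup>2 * (ln x - ln (x powr \<delta>))
     + C * (x powr \<delta>)\<^sup>2 * (1 + ln (ln (x powr \<delta>)))) / (2 * x powr \<delta>) \<le> x powr (1 - \<delta>)) at_top"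
  using assms by real_asymp

text \<open>
  In the critical cases the leading terms cancel exactly; these identities remove them
  before asymptotic expansions are compared.
\<close>

lemma sqrt_ratio_identities:
  fixes c x :: real
  assumes "c > 0" "x > 1"
  defines "k \<equiv> sqrt (c * x / ln x)"
  shows "k > 0" "c * x = k\<^sup>2 * ln x" "ln k = (ln c + ln x - ln (ln x)) / 2"
    "sqrt (1/2 * x * ln x) = k * ln x / sqrt (2 * c)"
proof -
  have l: "ln x > 0" using assms by simp
  show k: "k > 0" using assms l by (simp add: k_def)
  show k2: "c * x = k\<^sup>2 * ln x" using assms l by (simp add: k_def)
  show "ln k = (ln c + ln x - ln (ln x)) / 2"
    using assms l by (simp add: k_def ln_sqrt ln_mult ln_div)
  show "sqrt (1/2 * x * ln x) = k * ln x / sqrt (2 * c)"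
  proof (rule real_sqrt_unique)
    show "0 \<le> k * ln x / sqrt (2 * c)" using k l assms by simp
    have "(sqrt (2 * c))\<^sup>2 = 2 * c" using assms by simp
    then have "(k * ln x / sqrt (2 * c))\<^sup>2 = (k\<^sup>2 * ln x) * ln x / (2 * c)"
      by (simp only: power_mult_distrib power_divide) (simp only: power2_eq_square mult.assoc)
    also have "\<dots> = 1/2 * x * ln x" using assms unfolding k2[symmetric] by simp
    finally show "(k * ln x / sqrt (2 * c))\<^sup>2 = 1/2 * x * ln x" .
  qed
qed

text \<open>For \<open>c = 2\<close> the length term \<open>x / (2 * k)\<close> and the moment term
  each contribute \<open>k * ln x / 4\<close>, and together they are exactly
  \<open>sqrt (1/2 * x * ln x)\<close>. What is left is \<open>h\<close>, whose largest terms have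
  size \<open>k * ln (ln x)\<close>.\<close>

lemma upper_exponent_critical:
  fixes C :: real
  obtains A where "A \<ge> 0"
    "eventually (\<lambda>x. \<forall>k. k = sqrt (2 * x / ln x) \<longrightarrow>
       ln 2 + (x + C * ln x + C * (x / k) + k\<^sup>2 * (ln x - ln k) + C * k\<^sup>2 * (1 + ln (ln k))) / (2 * k)
       \<le> sqrt (1/2 * x * ln x) + A * (sqrt x * ln (ln x) / sqrt (ln x))) at_top"
proof -
  define g where "g = (\<lambda>x::real. sqrt x * ln (ln x) / sqrt (ln x))"
  define h where "h = (\<lambda>x::real. ln 2 + C * ln x / (2 * sqrt (2 * x / ln x)) + C * ln x / 4
      + sqrt (2 * x / ln x) / 4 * (ln (ln x) - ln 2) + C * sqrt (2 * x / ln x) / 2 * (1 + ln (ln (sqrt (2 * x / ln x)))))"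
  have "h \<in> O[at_top](g)" unfolding h_def g_def by real_asymp
  then obtain A where A: "A > 0" "eventually (\<lambda>x. norm (h x) \<le> A * norm (g x)) at_top"
    by (auto elim!: landau_o.bigE)
  have "eventually (\<lambda>x. g x \<ge> 0) at_top" unfolding g_def by real_asymp
  with A(2) eventually_gt_at_top[of "1::real"]
  have "eventually (\<lambda>x. \<forall>k. k = sqrt (2 * x / ln x) \<longrightarrow>
       ln 2 + (x + C * ln x + C * (x / k) + k\<^sup>2 * (ln x - ln k) + C * k\<^sup>2 * (1 + ln (ln k))) / (2 * k)
       \<le> sqrt (1/2 * x * ln x) + A * g x) at_top"
  proof eventually_elim
    case (elim x)
    define k where "k = sqrt (2 * x / ln x)"
    note I = sqrt_ratio_identities[of 2 x, folded k_def]
    have k: "k > 0" and x: "x = k\<^sup>2 * ln x / 2" and lnk: "ln k = (ln 2 + ln x - ln (ln x)) / 2"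
      and sq: "sqrt (1/2 * x * ln x) = k * ln x / 2"
      using I elim by auto
    \<comment> \<open>With the logarithms abbreviated, the next identity is a rational one in
      \<open>k\<close>.\<close>
    define lx llk where "lx = ln x" and "llk = ln (ln k)"
    have "ln 2 + (x + C * ln x + C * (x / k) + k\<^sup>2 * (ln x - ln k) + C * k\<^sup>2 * (1 + ln (ln k))) / (2 * k)
       = ln 2 + (k\<^sup>2 * lx / 2 + C * lx + C * ((k\<^sup>2 * lx / 2) / k) + k\<^sup>2 * (lx - (ln 2 + lx - ln lx) / 2) + C * k\<^sup>2 * (1 + llk)) / (2 * k)"
      unfolding llk_def unfolding lnk unfolding lx_def x[symmetric] ..
    also have "\<dots> = k * lx / 2 + (ln 2 + C * lx / (2 * k) + C * lx / 4 + k / 4 * (ln lx - ln 2) + C * k / 2 * (1 + llk))"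
      using k by (simp add: field_simps power2_eq_square)
    also have "\<dots> = sqrt (1/2 * x * ln x) + h x"
      unfolding sq h_def k_def[symmetric] lx_def llk_def ..
    also have "\<dots> \<le> sqrt (1/2 * x * ln x) + A * g x" using elim by simp
    finally show ?case by (simp add: k_def)
  qed
  then show ?thesis using A(1) unfolding g_def by (intro that[of A]) auto
qed

text \<open>For \<open>c = 8\<close> the moment alone gives the main term, since
  \<open>k * ln x / 4\<close> equals \<open>sqrt (1/2 * x * ln x)\<close>.\<close>

lemma lower_exponent_critical:
  fixes C :: real
  obtains A where "A \<ge> 0"
    "eventually (\<lambda>x. \<forall>k. k = sqrt (8 * x / ln x) \<longrightarrow>
       sqrt (1/2 * x * ln x) - A * (sqrt x * ln (ln x) / sqrt (ln x)) \<le>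
       (k\<^sup>2 * (ln x - ln k) - C * k\<^sup>2 * (1 + ln (ln k))) / (2 * k)) at_top"
proof -
  define g where "g = (\<lambda>x::real. sqrt x * ln (ln x) / sqrt (ln x))"
  define h where "h = (\<lambda>x::real. sqrt (8 * x / ln x) / 4 * (ln (ln x) - ln 8)
      - C * sqrt (8 * x / ln x) / 2 * (1 + ln (ln (sqrt (8 * x / ln x)))))"
  have "h \<in> O[at_top](g)" unfolding h_def g_def by real_asymp
  then obtain A where A: "A > 0" "eventually (\<lambda>x. norm (h x) \<le> A * norm (g x)) at_top"
    by (auto elim!: landau_o.bigE)
  have "eventually (\<lambda>x. g x \<ge> 0) at_top" unfolding g_def by real_asymp
  with A(2) eventually_gt_at_top[of "1::real"]
  have "eventually (\<lambda>x. \<forall>k. k = sqrt (8 * x / ln x) \<longrightarrow>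
       sqrt (1/2 * x * ln x) - A * g x \<le>
       (k\<^sup>2 * (ln x - ln k) - C * k\<^sup>2 * (1 + ln (ln k))) / (2 * k)) at_top"
  proof eventually_elim
    case (elim x)
    define k where "k = sqrt (8 * x / ln x)"
    note I = sqrt_ratio_identities[of 8 x, folded k_def]
    have "sqrt 16 = (4::real)" by (rule real_sqrt_unique) auto
    then have k: "k > 0" and lnk: "ln k = (ln 8 + ln x - ln (ln x)) / 2"
      and sq: "sqrt (1/2 * x * ln x) = k * ln x / 4"
      using I elim by auto
    define lx llk where "lx = ln x" and "llk = ln (ln k)"
    have "(k\<^sup>2 * (ln x - ln k) - C * k\<^sup>2 * (1 + ln (ln k))) / (2 * k)
       = (k\<^sup>2 * (lx - (ln 8 + lx - ln lx) / 2) - C * k\<^sup>2 * (1 + llk)) / (2 * k)"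
      unfolding llk_def unfolding lnk unfolding lx_def ..
    also have "\<dots> = k * lx / 4 + (k / 4 * (ln lx - ln 8) - C * k / 2 * (1 + llk))"
      using k by (simp add: field_simps power2_eq_square)
    also have "\<dots> = sqrt (1/2 * x * ln x) + h x"
      unfolding sq h_def k_def[symmetric] lx_def llk_def ..
    also have "\<dots> \<ge> sqrt (1/2 * x * ln x) - A * g x" using elim by (simp add: abs_le_iff)
    finally show ?case by (simp add: k_def)
  qed
  then show ?thesis using A(1) unfolding g_def by (intro that[of A]) auto
qed

text \<open>The value \<open>k (2 * T)\<close> enters because the derivative bound on \<open>[0, T]\<close> involves \<open>zeta_max (2 * T)\<close>.\<close>

lemma zeta_max_two_stage:
  fixes k :: "real \<Rightarrow> real" and A :: real
  assumes mf: "moment_formula k" and k: "filterlim k at_top at_top"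
    and growth: "eventually (\<lambda>T. (k T)\<^sup>2 * ln (ln T) \<le> A * ln T) at_top"
  obtains C :: real where "C \<ge> 1"
    "eventually (\<lambda>T. zeta_max T \<le> C * ln T \<or>
       2 * k T * (ln (zeta_max T) - ln 2) \<le> ln T + C * ln (ln T) + C * (ln T / k (2 * T))
          + (k T)\<^sup>2 * (ln (ln T) - ln (k T)) + C * (k T)\<^sup>2 * (1 + ln (ln (k T)))) at_top"
proof -
  obtain C0 :: real where C0: "C0 \<ge> 0"
    "eventually (\<lambda>T. zeta_moment (k T) T > 0 \<and>
       \<bar>ln (zeta_moment (k T) T) - (k T)\<^sup>2 * (ln (ln T) - ln (k T))\<bar> \<le> C0 * (k T)\<^sup>2 * (1 + ln (ln (k T)))) at_top"
    using ln_zeta_moment[OF mf k] by blast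
  obtain C :: real where C: "C \<ge> 1"
    "\<And>k T D. k > 0 \<Longrightarrow> T \<ge> exp 1 \<Longrightarrow> D \<ge> 1 \<Longrightarrow> zeta_max T > C * ln T \<Longrightarrow>
       (\<And>t. t \<in> {2 * ln T..T} \<Longrightarrow> norm (deriv zeta (Complex (1/2) t)) \<le> D) \<Longrightarrow>
       zeta_moment k T > 0 \<and>
       2 * k * (ln (zeta_max T) - ln 2) \<le> ln (2 * D) + ln T + ln (zeta_moment k T)"
    by (rule zeta_max_upper) blast
  obtain C1 :: real where C1: "C1 \<ge> 1"
    "\<And>t T. 2 \<le> t \<Longrightarrow> t \<le> T \<Longrightarrow> norm (deriv zeta (Complex (1/2) t)) \<le> C1 * T"
    by (rule deriv_zeta_crude) blast
  obtain C2 :: real where C2: "C2 \<ge> 1"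
    "\<And>t T. T \<ge> exp 4 \<Longrightarrow> 2 * ln T \<le> t \<Longrightarrow> t \<le> T \<Longrightarrow>
       norm (deriv zeta (Complex (1/2) t)) \<le> C2 * ln T * (zeta_max (2 * T) + 1)"
    by (rule deriv_zeta_refined) blast
  have ev_k: "eventually (\<lambda>T. k T \<ge> max 3 A) at_top" using k unfolding filterlim_at_top by blast
  \<comment> \<open>\<open>K\<close> collects the multiples of \<open>ln T\<close> in the first
    stage: \<open>ln (2 * C1)\<close> and 2 come from \<open>ln (2 * D) + ln T\<close> with
    \<open>D = C1 * T\<close>, the last summand from the moment.\<close>
  define K where "K = ln (2 * C1) + 2 + (1 + C0) * \<bar>A\<bar>"
  have lnC1: "ln (2 * C1) \<ge> 0" using C1 by simp
  then have K: "K \<ge> 0" using C0 unfolding K_def by (intro add_nonneg_nonneg mult_nonneg_nonneg) auto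
  define C3 where "C3 = ln C + 2 + K"
  have lnC: "ln C \<ge> 0" using C by simp
  then have C3: "C3 \<ge> 0" using K by (simp add: C3_def)
  \<comment> \<open>First stage, with the crude derivative bound. The size of \<open>C3\<close> does
    not matter, since this estimate will only enter through \<open>ln D\<close>.\<close>
  have "eventually (\<lambda>T. zeta_max T \<le> exp (C3 * (ln T / k T))) at_top"
    using eventually_ge_at_top[of "exp 3"] ev_k growth C0(2)
  proof eventually_elim
    case (elim T)
    have T0: "T > 0" using elim(1) exp_gt_zero[of 3] by linarith
    have L: "ln T \<ge> 3" using elim(1) T0 by (simp add: ln_ge_iff)
    have LL: "ln (ln T) \<ge> 1" using L exp_le by (subst ln_ge_iff) linarith+
    have kT: "k T \<ge> 3" "k T \<ge> A" using elim(2) by auto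
    have "A * ln T \<le> k T * ln T" using kT L by (intro mult_right_mono) auto
    then have "k T * (k T * ln (ln T)) \<le> k T * ln T"
      using elim(3) by (simp add: power2_eq_square mult.assoc)
    \<comment> \<open>Hence \<open>ln T / k T\<close> dominates \<open>ln (ln T)\<close>, and the
      alternative \<open>zeta_max T \<le> C * ln T\<close> also fits under
      \<open>exp (C3 * (ln T / k T))\<close>.\<close>
    then have kLL: "k T * ln (ln T) \<le> ln T" using kT by simp
    have "k T * 1 \<le> k T * ln (ln T)" using kT LL by (intro mult_left_mono) auto
    with kLL have kL: "k T \<le> ln T" by simp
    have q1: "ln T / k T \<ge> 1" using kL kT by simp
    have q2: "ln T / k T \<ge> ln (ln T)" using kLL kT by (simp add: field_simps)
    show ?case
    proof (cases "zeta_max T \<le> C * ln T")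
      case True
      also have "C * ln T = exp (ln C + ln (ln T))" using C L by (simp add: exp_add)
      also have "\<dots> \<le> exp (C3 * (ln T / k T))"
      proof -
        have "ln C + ln (ln T) \<le> ln C * (ln T / k T) + 1 * (ln T / k T)"
          using mult_left_mono[OF q1 lnC] q2 by linarith
        also have "\<dots> \<le> C3 * (ln T / k T)"
          unfolding C3_def using K q1 by (simp only: distrib_right[symmetric]) (intro mult_right_mono, auto)
        finally show ?thesis by simp
      qed
      finally show ?thesis .
    next
      case False
      have lnk: "ln (k T) \<ge> 1" using kT exp_le ln_ge_iff[of "k T" 1] by linarith
      have "T \<ge> exp 1" using elim(1) exp_le_cancel_iff[of 1 "3::real"] by linarith
      moreover have "C1 * T \<ge> 1"
        using C1 \<open>T \<ge> exp 1\<close> one_le_exp_iff[of 1] mult_mono[of 1 C1 1 T] by linarith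
      moreover have "norm (deriv zeta (Complex (1/2) t)) \<le> C1 * T" if "t \<in> {2 * ln T..T}" for t
        using that L by (intro C1) auto
      ultimately have up: "2 * k T * (ln (zeta_max T) - ln 2) \<le> ln (2 * (C1 * T)) + ln T + ln (zeta_moment (k T) T)"
        using C(2)[of "k T" T "C1 * T"] kT False by auto
      have lnD: "ln (2 * (C1 * T)) = ln (2 * C1) + ln T" using C1 T0 by (simp add: ln_mult)
      \<comment> \<open>As \<open>k T \<le> ln T\<close>, the bracket in the moment error is at most
        \<open>ln (ln T)\<close>, and \<open>growth\<close> then makes the logarithm of the whole
        moment \<open>O(ln T)\<close>.\<close>
      have "ln (ln (k T)) \<le> ln (ln (ln T))"
        using kL kT lnk L LL by (simp add: ln_mono)
      also have "\<dots> \<le> ln (ln T) - 1" using LL by (intro ln_le_minus_one) auto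
      finally have llk: "1 + ln (ln (k T)) \<le> ln (ln T)" by simp
      have "ln (zeta_moment (k T) T) \<le> (k T)\<^sup>2 * (ln (ln T) - ln (k T)) + C0 * (k T)\<^sup>2 * (1 + ln (ln (k T)))"
        using elim(4) by (simp add: abs_le_iff)
      also have "\<dots> \<le> (k T)\<^sup>2 * ln (ln T) + C0 * (k T)\<^sup>2 * ln (ln T)"
        using lnk llk C0 by (intro add_mono mult_left_mono) auto
      also have "\<dots> = (1 + C0) * ((k T)\<^sup>2 * ln (ln T))" by (simp add: algebra_simps)
      also have "\<dots> \<le> (1 + C0) * (\<bar>A\<bar> * ln T)"
      proof (rule mult_left_mono)
        have "A * ln T \<le> \<bar>A\<bar> * ln T" using L by (intro mult_right_mono) auto
        then show "(k T)\<^sup>2 * ln (ln T) \<le> \<bar>A\<bar> * ln T" using elim(3) by linarith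
      qed (use C0 in auto)
      finally have "ln (zeta_moment (k T) T) \<le> (1 + C0) * \<bar>A\<bar> * ln T" by simp
      moreover have "ln (2 * C1) \<le> ln (2 * C1) * ln T" using lnC1 L mult_left_mono[of 1 "ln T" "ln (2 * C1)"] by simp
      ultimately have "2 * k T * (ln (zeta_max T) - ln 2) \<le> K * ln T"
        using up unfolding lnD K_def by (simp add: distrib_right)
      then have "ln (zeta_max T) - ln 2 \<le> K * ln T / (2 * k T)"
        using kT by (simp add: field_simps)
      also have "\<dots> \<le> K * (ln T / k T)"
      proof -
        have "0 \<le> K * (ln T / k T)" using K q1 by (intro mult_nonneg_nonneg) auto
        moreover have "K * ln T / (2 * k T) = K * (ln T / k T) / 2" by simp
        moreover have "b \<le> a" if "0 \<le> a" "b = a / 2" for a b :: real using that by simp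
        ultimately show ?thesis by blast
      qed
      finally have "ln (zeta_max T) \<le> ln 2 + K * (ln T / k T)" by simp
      also have "ln 2 \<le> (ln C + 2) * 1" unfolding mult_1_right using ln_2_less_1 lnC by linarith
      also have "(ln C + 2) * 1 \<le> (ln C + 2) * (ln T / k T)" using q1 lnC by (intro mult_left_mono) auto
      also have "(ln C + 2) * (ln T / k T) + K * (ln T / k T) = C3 * (ln T / k T)"
        unfolding C3_def by (rule distrib_right[symmetric])
      finally have *: "ln (zeta_max T) \<le> C3 * (ln T / k T)" by simp
      have "0 < C * ln T" using C L by simp
      then have "zeta_max T > 0" using False by linarith
      then show ?thesis using * by (metis exp_le_cancel_iff exp_ln)
    qed
  qed
  \<comment> \<open>Explicit thresholds are extracted because these bounds are next applied at
    \<open>2 * T\<close>.\<close>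
  then obtain N where N: "\<And>T. T \<ge> N \<Longrightarrow> zeta_max T \<le> exp (C3 * (ln T / k T))"
    by (auto simp: eventually_at_top_linorder)
  obtain N' where N': "\<And>T. T \<ge> N' \<Longrightarrow> k T \<ge> max 3 A"
    using ev_k by (auto simp: eventually_at_top_linorder)
  define C4 where "C4 = C + ln (4 * C2) + 1 + 2 * C3 + C0"
  have lnC2: "ln (4 * C2) \<ge> 0" using C2 by simp
  have C4: "C4 \<ge> C" "C4 \<ge> ln (4 * C2) + 1" "C4 \<ge> 2 * C3" "C4 \<ge> C0"
    using lnC2 C C0 C3 unfolding C4_def by linarith+
  have "eventually (\<lambda>T. zeta_max T \<le> C4 * ln T \<or>
       2 * k T * (ln (zeta_max T) - ln 2) \<le> ln T + C4 * ln (ln T) + C4 * (ln T / k (2 * T))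
          + (k T)\<^sup>2 * (ln (ln T) - ln (k T)) + C4 * (k T)\<^sup>2 * (1 + ln (ln (k T)))) at_top"
    using eventually_ge_at_top[of "exp 4"] eventually_ge_at_top[of N] eventually_ge_at_top[of N'] ev_k C0(2)
  proof eventually_elim
    case (elim T)
    have T0: "T > 0" using elim(1) exp_gt_zero[of 4] by linarith
    have L: "ln T \<ge> 4" using elim(1) T0 by (simp add: ln_ge_iff)
    have LL: "ln (ln T) \<ge> 1" using L exp_le by (subst ln_ge_iff) linarith+
    have kT: "k T \<ge> 3" "k (2 * T) \<ge> 3" using elim(4) N'[of "2 * T"] elim(3) T0 by auto
    have lnk: "ln (k T) \<ge> 1" using kT exp_le ln_ge_iff[of "k T" 1] by linarith
    show ?case
    proof (cases "zeta_max T \<le> C * ln T")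
      case True
      also have "C * ln T \<le> C4 * ln T" using C4 L by (intro mult_right_mono) auto
      finally show ?thesis by blast
    next
      case False
      \<comment> \<open>An upper bound for the first-stage exponent at \<open>2 * T\<close>; the
        factor 2 comes from \<open>ln (2 * T) \<le> 2 * ln T\<close>.\<close>
      define q where "q = 2 * C3 * (ln T / k (2 * T))"
      have q: "q \<ge> 0" using C3 L kT by (simp add: q_def)
      have "ln 2 \<le> ln T" using ln_2_less_1 L by linarith
      then have "ln (2 * T) \<le> 2 * ln T" using T0 by (simp add: ln_mult)
      then have "ln (2 * T) / k (2 * T) \<le> 2 * ln T / k (2 * T)" using kT by (intro divide_right_mono) auto
      then have "C3 * (ln (2 * T) / k (2 * T)) \<le> C3 * (2 * ln T / k (2 * T))"
        using C3 by (rule mult_left_mono)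
      then have "C3 * (ln (2 * T) / k (2 * T)) \<le> q" by (simp add: q_def mult_ac)
      then have "zeta_max (2 * T) \<le> exp q"
      proof -
        have "2 * T \<ge> N" using elim(2) T0 by linarith
        from N[OF this] show ?thesis
          using \<open>C3 * (ln (2 * T) / k (2 * T)) \<le> q\<close> by (meson exp_le_cancel_iff order_trans)
      qed
      moreover have "exp q \<ge> 1" using q by simp
      ultimately have zq: "zeta_max (2 * T) + 1 \<le> 2 * exp q" by linarith
      \<comment> \<open>Now \<open>ln (2 * D)\<close> is \<open>ln (ln T) + q\<close> up to a
        constant, where the crude bound had a second \<open>ln T\<close>.\<close>
      define D where "D = C2 * ln T * (2 * exp q)"
      have "1 * 1 \<le> C2 * ln T" using C2 L by (intro mult_mono) auto
      moreover have "1 \<le> 2 * exp q" using \<open>exp q \<ge> 1\<close> by linarith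
      ultimately have "1 * 1 \<le> D" unfolding D_def by (intro mult_mono) auto
      moreover have "norm (deriv zeta (Complex (1/2) t)) \<le> D" if "t \<in> {2 * ln T..T}" for t
      proof -
        have "norm (deriv zeta (Complex (1/2) t)) \<le> C2 * ln T * (zeta_max (2 * T) + 1)"
          using that elim(1) by (intro C2) auto
        also have "\<dots> \<le> D" unfolding D_def using C2 L zq by (intro mult_left_mono) auto
        finally show ?thesis .
      qed
      moreover have "T \<ge> exp 1" using elim(1) exp_le_cancel_iff[of 1 "4::real"] by linarith
      ultimately have up: "2 * k T * (ln (zeta_max T) - ln 2) \<le> ln (2 * D) + ln T + ln (zeta_moment (k T) T)"
        using C(2)[of "k T" T D] kT False by auto
      have lnD: "ln (2 * D) = ln (4 * C2) + ln (ln T) + q"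
      proof -
        have "2 * D = (4 * C2) * ln T * exp q" by (simp add: D_def)
        then show ?thesis using C2 L by (simp only:) (simp add: ln_mult)
      qed
      have "ln (4 * C2) + ln (ln T) \<le> (ln (4 * C2) + 1) * ln (ln T)"
        using mult_left_mono[OF LL lnC2] by (simp add: distrib_right)
      also have "\<dots> \<le> C4 * ln (ln T)" using C4 LL by (intro mult_right_mono) auto
      finally have e1: "ln (4 * C2) + ln (ln T) \<le> C4 * ln (ln T)" .
      have e2: "q \<le> C4 * (ln T / k (2 * T))"
        unfolding q_def using C4 L kT by (intro mult_right_mono) auto
      have e3: "C0 * (k T)\<^sup>2 * (1 + ln (ln (k T))) \<le> C4 * (k T)\<^sup>2 * (1 + ln (ln (k T)))"
        using C4 lnk by (intro mult_right_mono) auto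
      have e4: "ln (zeta_moment (k T) T) \<le> (k T)\<^sup>2 * (ln (ln T) - ln (k T)) + C0 * (k T)\<^sup>2 * (1 + ln (ln (k T)))"
        using elim(5) by (simp add: abs_le_iff)
      show ?thesis using up e1 e2 e3 e4 unfolding lnD by (intro disjI2) linarith
    qed
  qed
  then show ?thesis using C C4 by (intro that[of C4]) auto
qed


section \<open>From exponents to the three estimates\<close>

lemma zeta_max_bigo_exp:
  fixes B F k :: "real \<Rightarrow> real"
  assumes C: "C \<ge> 1"
    and dich: "eventually (\<lambda>T. zeta_max T \<le> C * ln T \<or> 2 * k T * (ln (zeta_max T) - ln 2) \<le> B T) at_top"
    and k: "eventually (\<lambda>T. k T > 0) at_top"
    and B: "eventually (\<lambda>T. ln 2 + B T / (2 * k T) \<le> F T) at_top"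
    and F: "eventually (\<lambda>T. ln T \<le> exp (F T)) at_top"
  shows "zeta_max \<in> O[at_top](\<lambda>T. exp (F T))"
proof (rule bigoI[where c = C])
  show "eventually (\<lambda>T. norm (zeta_max T) \<le> C * norm (exp (F T))) at_top"
    using dich k B F eventually_gt_at_top[of "0::real"]
  proof eventually_elim
    case (elim T)
    have nn: "zeta_max T \<ge> 0" using elim(5) by (intro zeta_max_nonneg) auto
    have "zeta_max T \<le> C * exp (F T)"
    proof (cases "zeta_max T \<le> C * ln T")
      case True
      also have "C * ln T \<le> C * exp (F T)" using elim(4) C by (intro mult_left_mono) auto
      finally show ?thesis .
    next
      case False
      then have "2 * k T * (ln (zeta_max T) - ln 2) \<le> B T" using elim(1) by blast
      then have "ln (zeta_max T) - ln 2 \<le> B T / (2 * k T)"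
        using elim(2) by (simp add: pos_le_divide_eq mult.commute)
      then have le: "ln (zeta_max T) \<le> F T" using elim(3) by linarith
      have "zeta_max T \<le> exp (F T)"
      \<comment> \<open>The value 0 is treated separately, because \<open>ln 0\<close> says nothing
        about it and \<open>ln T\<close> may still be negative here.\<close>
      proof (cases "zeta_max T = 0")
        case False
        then have "zeta_max T = exp (ln (zeta_max T))" using nn by simp
        then show ?thesis using le by (metis exp_le_cancel_iff)
      qed simp
      also have "\<dots> \<le> C * exp (F T)" using C by simp
      finally show ?thesis .
    qed
    then show ?case using nn by simp
  qed
qed

lemma zeta_max_bigo_linear: "zeta_max \<in> O[at_top](\<lambda>T. T)"
proof -
  obtain C :: real where C: "C \<ge> 1"
    "\<And>t T. T \<ge> 1 \<Longrightarrow> t \<in> {0..T} \<Longrightarrow> norm (zeta (Complex (1/2) t)) \<le> C * T"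
    by (rule zeta_strip_bound) blast
  show ?thesis
  proof (rule bigoI[where c = C])
    show "eventually (\<lambda>T. norm (zeta_max T) \<le> C * norm T) at_top"
      using eventually_ge_at_top[of "1::real"]
    proof eventually_elim
      case (elim T)
      then obtain t where "t \<in> {0..T}" "zeta_max T = norm (zeta (Complex (1/2) t))"
        using zeta_max_attained[of T] by auto
      then show ?case using C(2)[of T t] elim by simp
    qed
  qed
qed

lemma zeta_max_upper_power:
  fixes \<delta> :: real
  assumes \<delta>: "\<delta> < 1/2" and mf: "moment_formula (\<lambda>T. ln T powr \<delta>)"
  shows "zeta_max \<in> O[at_top](\<lambda>T. exp (ln T powr (1 - \<delta>)))"
proof (cases "\<delta> \<le> 0")
  case True
  \<comment> \<open>Now \<open>1 - \<delta> \<ge> 1\<close>, so the target is at least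
    \<open>T\<close> once \<open>ln T \<ge> 1\<close>, and the linear growth bound suffices.\<close>
  have "(\<lambda>T. T) \<in> O[at_top](\<lambda>T. exp (ln T powr (1 - \<delta>)))"
  proof (rule bigoI[where c = 1])
    show "eventually (\<lambda>T::real. norm T \<le> 1 * norm (exp (ln T powr (1 - \<delta>)))) at_top"
      using eventually_ge_at_top[of "exp 1"]
    proof eventually_elim
      case (elim T)
      then have T: "T > 0" using exp_gt_zero[of 1] by linarith
      then have L: "ln T \<ge> 1" using elim by (simp add: ln_ge_iff)
      have "T = exp (ln T)" using T by simp
      also have "\<dots> \<le> exp (ln T powr (1 - \<delta>))"
        using powr_mono[of 1 "1 - \<delta>" "ln T"] True L by simp
      finally show ?case using T by simp
    qed
  qed
  with zeta_max_bigo_linear show ?thesis by (rule landau_o.big_trans)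
next
  case False
  then have \<delta>0: "\<delta> > 0" by simp
  define k where "k = (\<lambda>T. ln T powr \<delta>)"
  have "filterlim k at_top at_top" unfolding k_def using \<delta>0 by real_asymp
  \<comment> \<open>The left-hand side is \<open>(ln T) powr (2 * \<delta>) * ln (ln T)\<close>, so
    this is where \<open>\<delta> < 1/2\<close> enters.\<close>
  moreover have "eventually (\<lambda>T. (k T)\<^sup>2 * ln (ln T) \<le> 1 * ln T) at_top"
    unfolding k_def using \<delta>0 \<delta> by real_asymp
  ultimately obtain C :: real where C: "C \<ge> 1"
    "eventually (\<lambda>T. zeta_max T \<le> C * ln T \<or>
       2 * k T * (ln (zeta_max T) - ln 2) \<le> ln T + C * ln (ln T) + C * (ln T / k (2 * T))
          + (k T)\<^sup>2 * (ln (ln T) - ln (k T)) + C * (k T)\<^sup>2 * (1 + ln (ln (k T)))) at_top"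
    using zeta_max_two_stage[of k 1] mf unfolding k_def by blast
  show ?thesis
  proof (rule zeta_max_bigo_exp[OF C])
    show "eventually (\<lambda>T. k T > 0) at_top" unfolding k_def by real_asymp
    have "eventually (\<lambda>x. x \<le> exp (x powr e)) at_top" if "e > 0" for e :: real
      using that by real_asymp
    from eventually_compose_filterlim[OF this ln_at_top]
    show "eventually (\<lambda>T. ln T \<le> exp (ln T powr (1 - \<delta>))) at_top" using \<delta> by simp
    show "eventually (\<lambda>T. ln 2 + (ln T + C * ln (ln T) + C * (ln T / k (2 * T))
          + (k T)\<^sup>2 * (ln (ln T) - ln (k T)) + C * (k T)\<^sup>2 * (1 + ln (ln (k T)))) / (2 * k T)
           \<le> ln T powr (1 - \<delta>)) at_top"
      using eventually_compose_filterlim[OF upper_exponent_power[OF \<delta>0 \<delta>, of C] ln_at_top]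
        eventually_gt_at_top[of "1::real"]
    proof eventually_elim
      case (elim T)
      \<comment> \<open>Monotonicity of \<open>k\<close> removes the argument \<open>2 * T\<close>,
        and the exponent becomes a function of \<open>ln T\<close> alone.\<close>
      have kk: "0 < k T" "k T \<le> k (2 * T)" unfolding k_def using elim \<delta>0 by (auto intro!: powr_mono2)
      then have "C * (ln T / k (2 * T)) \<le> C * (ln T / k T)"
        using C elim by (intro mult_left_mono divide_left_mono mult_pos_pos) auto
      then have "(ln T + C * ln (ln T) + C * (ln T / k (2 * T))
          + (k T)\<^sup>2 * (ln (ln T) - ln (k T)) + C * (k T)\<^sup>2 * (1 + ln (ln (k T)))) / (2 * k T) \<le>
         (ln T + C * ln (ln T) + C * (ln T / k T)
          + (k T)\<^sup>2 * (ln (ln T) - ln (k T)) + C * (k T)\<^sup>2 * (1 + ln (ln (k T)))) / (2 * k T)"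
        using kk by (intro divide_right_mono add_mono order_refl) auto
      then show ?case using elim(1) unfolding k_def by linarith
    qed
  qed
qed

lemma zeta_max_upper_critical:
  assumes mf: "moment_formula (\<lambda>T. sqrt (2 * ln T / ln (ln T)))"
  shows "\<exists>E :: real \<Rightarrow> real.
               E \<in> O[at_top](\<lambda>T. sqrt (ln T) * ln (ln (ln T)) / sqrt (ln (ln T))) \<and>
               zeta_max \<in> O[at_top](\<lambda>T. exp (sqrt (1/2 * ln T * ln (ln T)) + E T))"
proof -
  define k where "k = (\<lambda>T. sqrt (2 * ln T / ln (ln T)))"
  define g where "g = (\<lambda>T::real. sqrt (ln T) * ln (ln (ln T)) / sqrt (ln (ln T)))"
  have "filterlim k at_top at_top" unfolding k_def by real_asymp
  moreover have "eventually (\<lambda>T. (k T)\<^sup>2 * ln (ln T) \<le> 2 * ln T) at_top"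
    using eventually_gt_at_top[of "exp 1"]
  proof eventually_elim
    case (elim T)
    then have "T > 0" using exp_gt_zero[of 1] by linarith
    then have "ln T > 1" using elim by (metis exp_less_cancel_iff exp_ln)
    then show ?case by (simp add: k_def)
  qed
  ultimately obtain C :: real where C: "C \<ge> 1"
    "eventually (\<lambda>T. zeta_max T \<le> C * ln T \<or>
       2 * k T * (ln (zeta_max T) - ln 2) \<le> ln T + C * ln (ln T) + C * (ln T / k (2 * T))
          + (k T)\<^sup>2 * (ln (ln T) - ln (k T)) + C * (k T)\<^sup>2 * (1 + ln (ln (k T)))) at_top"
    using zeta_max_two_stage[of k 2] mf unfolding k_def by blast
  obtain A where A: "A \<ge> 0"
    "eventually (\<lambda>x. \<forall>k. k = sqrt (2 * x / ln x) \<longrightarrow>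
       ln 2 + (x + C * ln x + C * (x / k) + k\<^sup>2 * (ln x - ln k) + C * k\<^sup>2 * (1 + ln (ln k))) / (2 * k)
       \<le> sqrt (1/2 * x * ln x) + A * (sqrt x * ln (ln x) / sqrt (ln x))) at_top"
    using upper_exponent_critical by blast
  have k_pos: "eventually (\<lambda>T. k T > 0) at_top" unfolding k_def by real_asymp
  have k_mono: "eventually (\<lambda>T. k T \<le> k (2 * T)) at_top" unfolding k_def by real_asymp
  have g_pos: "eventually (\<lambda>T. g T \<ge> 0) at_top" unfolding g_def by real_asymp
  have "zeta_max \<in> O[at_top](\<lambda>T. exp (sqrt (1/2 * ln T * ln (ln T)) + A * g T))"
  proof (rule zeta_max_bigo_exp[OF C])
    show "eventually (\<lambda>T. k T > 0) at_top" by (rule k_pos)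
    have "eventually (\<lambda>T. ln T \<le> exp (sqrt (1/2 * ln T * ln (ln T)))) at_top" by real_asymp
    with g_pos show "eventually (\<lambda>T. ln T \<le> exp (sqrt (1/2 * ln T * ln (ln T)) + A * g T)) at_top"
    proof eventually_elim
      case (elim T)
      have "exp (sqrt (1/2 * ln T * ln (ln T))) \<le> exp (sqrt (1/2 * ln T * ln (ln T)) + A * g T)"
        using elim(1) A by simp
      with elim(2) show ?case by linarith
    qed
    show "eventually (\<lambda>T. ln 2 + (ln T + C * ln (ln T) + C * (ln T / k (2 * T))
          + (k T)\<^sup>2 * (ln (ln T) - ln (k T)) + C * (k T)\<^sup>2 * (1 + ln (ln (k T)))) / (2 * k T)
           \<le> sqrt (1/2 * ln T * ln (ln T)) + A * g T) at_top"
      using eventually_compose_filterlim[OF A(2) ln_at_top] k_pos k_mono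
        eventually_gt_at_top[of "1::real"]
    proof eventually_elim
      case (elim T)
      have "C * (ln T / k (2 * T)) \<le> C * (ln T / k T)"
        using C elim by (intro mult_left_mono divide_left_mono mult_pos_pos) auto
      then have "(ln T + C * ln (ln T) + C * (ln T / k (2 * T))
          + (k T)\<^sup>2 * (ln (ln T) - ln (k T)) + C * (k T)\<^sup>2 * (1 + ln (ln (k T)))) / (2 * k T) \<le>
         (ln T + C * ln (ln T) + C * (ln T / k T)
          + (k T)\<^sup>2 * (ln (ln T) - ln (k T)) + C * (k T)\<^sup>2 * (1 + ln (ln (k T)))) / (2 * k T)"
        using elim by (intro divide_right_mono add_mono order_refl) auto
      moreover have "k T = sqrt (2 * ln T / ln (ln T))" by (simp add: k_def)
      ultimately show ?case using elim(1) unfolding g_def by fastforce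
    qed
  qed
  \<comment> \<open>The witness for \<open>E\<close> is \<open>A * g\<close>; the lower bound takes
    \<open>- A * g\<close> instead.\<close>
  moreover have "(\<lambda>T. A * g T) \<in> O[at_top](g)" by simp
  ultimately show ?thesis unfolding g_def by blast
qed

lemma zeta_max_lower_critical:
  assumes mf: "moment_formula (\<lambda>T. sqrt (8 * ln T / ln (ln T)))"
  shows "\<exists>E :: real \<Rightarrow> real.
               E \<in> O[at_top](\<lambda>T. sqrt (ln T) * ln (ln (ln T)) / sqrt (ln (ln T))) \<and>
               (\<lambda>T. exp (sqrt (1/2 * ln T * ln (ln T)) + E T)) \<in> O[at_top](zeta_max)"
proof -
  define k where "k = (\<lambda>T. sqrt (8 * ln T / ln (ln T)))"
  define g where "g = (\<lambda>T::real. sqrt (ln T) * ln (ln (ln T)) / sqrt (ln (ln T)))"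
  have "filterlim k at_top at_top" unfolding k_def by real_asymp
  then obtain C :: real where C: "C \<ge> 0"
    "eventually (\<lambda>T. zeta_moment (k T) T > 0 \<and>
       \<bar>ln (zeta_moment (k T) T) - (k T)\<^sup>2 * (ln (ln T) - ln (k T))\<bar> \<le> C * (k T)\<^sup>2 * (1 + ln (ln (k T)))) at_top"
    using ln_zeta_moment[of k] mf unfolding k_def by blast
  obtain A where A: "A \<ge> 0"
    "eventually (\<lambda>x. \<forall>k. k = sqrt (8 * x / ln x) \<longrightarrow>
       sqrt (1/2 * x * ln x) - A * (sqrt x * ln (ln x) / sqrt (ln x)) \<le>
       (k\<^sup>2 * (ln x - ln k) - C * k\<^sup>2 * (1 + ln (ln k))) / (2 * k)) at_top"
    using lower_exponent_critical by blast
  have k_pos: "eventually (\<lambda>T. k T > 0) at_top" unfolding k_def by real_asymp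
  have "(\<lambda>T. exp (sqrt (1/2 * ln T * ln (ln T)) + - A * g T)) \<in> O[at_top](zeta_max)"
  proof (rule bigoI[where c = 1])
    show "eventually (\<lambda>T. norm (exp (sqrt (1/2 * ln T * ln (ln T)) + - A * g T)) \<le> 1 * norm (zeta_max T)) at_top"
      using C(2) k_pos eventually_compose_filterlim[OF A(2) ln_at_top] eventually_gt_at_top[of "0::real"]
    proof eventually_elim
      case (elim T)
      note L = zeta_max_lower[OF elim(2) elim(4), OF conjunct1[OF elim(1)]]
      have "(k T)\<^sup>2 * (ln (ln T) - ln (k T)) - C * (k T)\<^sup>2 * (1 + ln (ln (k T))) \<le> 2 * k T * ln (zeta_max T)"
        using elim(1) L(2) by (simp add: abs_le_iff)
      then have "((k T)\<^sup>2 * (ln (ln T) - ln (k T)) - C * (k T)\<^sup>2 * (1 + ln (ln (k T)))) / (2 * k T) \<le> ln (zeta_max T)"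
        using elim(2) by (simp add: pos_divide_le_eq mult.commute)
      moreover have "sqrt (1/2 * ln T * ln (ln T)) - A * g T \<le>
          ((k T)\<^sup>2 * (ln (ln T) - ln (k T)) - C * (k T)\<^sup>2 * (1 + ln (ln (k T)))) / (2 * k T)"
        using elim(3) unfolding g_def k_def by blast
      ultimately have "sqrt (1/2 * ln T * ln (ln T)) + - A * g T \<le> ln (zeta_max T)" by simp
      then have "exp (sqrt (1/2 * ln T * ln (ln T)) + - A * g T) \<le> zeta_max T"
        using L(1) by (metis exp_le_cancel_iff exp_ln)
      then show ?case using L(1) by simp
    qed
  qed
  moreover have "(\<lambda>T. - A * g T) \<in> O[at_top](g)" by simp
  ultimately show ?thesis unfolding g_def by blast
qed

theorem theorem3p2:
  shows "(\<forall>\<delta>::real. \<delta> < 1/2 \<longrightarrow> moment_formula (\<lambda>T. ln T powr \<delta>) \<longrightarrow>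
            zeta_max \<in> O[at_top](\<lambda>T. exp (ln T powr (1 - \<delta>)))) \<and>
         (moment_formula (\<lambda>T. sqrt (2 * ln T / ln (ln T))) \<longrightarrow>
            (\<exists>E :: real \<Rightarrow> real.
               E \<in> O[at_top](\<lambda>T. sqrt (ln T) * ln (ln (ln T)) / sqrt (ln (ln T))) \<and>
               zeta_max \<in> O[at_top](\<lambda>T. exp (sqrt (1/2 * ln T * ln (ln T)) + E T)))) \<and>
         (moment_formula (\<lambda>T. sqrt (8 * ln T / ln (ln T))) \<longrightarrow>
            (\<exists>E :: real \<Rightarrow> real.
               E \<in> O[at_top](\<lambda>T. sqrt (ln T) * ln (ln (ln T)) / sqrt (ln (ln T))) \<and>
               (\<lambda>T. exp (sqrt (1/2 * ln T * ln (ln T)) + E T)) \<in> O[at_top](zeta_max)))"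
  using zeta_max_upper_power zeta_max_upper_critical zeta_max_lower_critical by blast

end
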